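(* Let $N\ge1$, $\rho>0$, let $n_0<\cdots<n_{N-1}<M$ be real numbers, and let the set of matrices $\mathcal{P}_0$, together with these exponents, be as in one of the settings (1)--(3) described in the context. Let $c_0,\ldots,c_{N-1}>0$, let $$\mathcal{C}:=\sum_{j=0}^{N-1}\frac{V(\mathbf{n}_j)^2}{V(\mathbf{n})^2}\frac{\rho^{M-n_j}}{c_j},\qquad \mathbf{n}:=(n_0,\ldots,n_{N-1}),\quad \mathbf{n}_j:=(n_0,\ldots,\widehat{n_j},\ldots,n_{N-1},M),$$ let $c'>-\mathcal{C}^{-1}$ be real, and set $$h(z)=\sum_{j=0}^{N-1}c_jz^{n_j},\qquad f(z)=h(z)+c'z^M,\qquad g(z)=h(z)-\mathcal{C}^{-1}z^M.$$ 1. Let $A\in\mathcal{P}_0$ and suppose $n_0=0$ if $A$ has a zero row. The following are equivalent. (a) There exists a vector $\mathbf{u}\in[0,\sqrt{\rho}]^N$ with distinct entries such that $A\ge\mathbf{u}\mathbf{u}^*$, and $\mathbf{u}$ has a zero entry if and only if $A$ has a zero row. (b) All of the rows of $A$ are distinct. (c) The matrix $h[A]$ is positive definite. (d) The inequality $A^{\circ M}\le\mathcal{C}\sum_{j=0}^{N-1}c_jA^{\circ n_j}$ is strict, that is, $f[A]$ is positive definite. Moreover, (c) is equivalent to (d). 2. Suppose $A\in\mathcal{P}_0$ has a row with distinct entries, and $n_0=0$ if any entry in this row is zero. Then $g[A]$ is positive definite. Furthermore, equality in $A^{\circ M}\le\mathcal{C}\sum_{j=0}^{N-1}c_jA^{\circ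 n_j}$ is attained on $\mathcal{P}_0$ if and only if either $N=1$ and $A=\rho$, or $n_0>0$ and $A=\mathbf{0}_{N\times N}$.
   Context: For $I\subseteq\mathbb{C}$ and positive integers $k\le N$, $\mathcal{P}_N^k(I)$ is the set of positive semidefinite (hence Hermitian) $N\times N$ matrices with entries in $I$ and rank at most $k$, and $\mathcal{P}_N(I):=\mathcal{P}_N^N(I)$. $\mathbb{Z}_+$ is the set of non-negative integers. For Hermitian matrices, $A\ge B$ (equivalently $B\le A$; Loewner order) means $A-B$ is positive semidefinite. For a matrix $A=(a_{ij})$, $f[A]:=(f(a_{ij}))$ and $A^{\circ\alpha}:=(a_{ij}^\alpha)$ (entrywise), with $0^0:=1$. $\mathbf{0}_{N\times N}$ is the zero matrix. In $\mathbf{n}_j$, $\widehat{n_j}$ indicates that $n_j$ is omitted. For an $N$-tuple $\mathbf{m}=(m_1,\ldots,m_N)$, $V(\mathbf{m}):=\prod_{1\le k<l\le N}(m_l-m_k)$ (empty product equal to $1$). Settings: (1) $\mathcal{P}_0=\mathcal{P}_N^1((0,\rho))$, with $n_0,\ldots,n_{N-1},M$ arbitrary real numbers. (2) $\mathcal{P}_N^1((0,\rho))\subseteq\mathcal{P}_0\subseteq\mathcal{P}_N^1([0,\rho])$, with $n_0,\ldots,n_{N-1},M$ non-negative real numbers. (3) $\mathcal{P}_N^1((0,\rho))\subseteq\mathcal{P}_0\subseteq\mathcal{P}_N([0,\rho])$, with $n_0,\ldots,n_{N-1},M\in\mathbb{Z}_+\cup[N-1,\infty)$.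
   Formalization: Item 2 is stated with the single case N=1 and A=(ρ) excluded: there the only row trivially has distinct nonzero entries, but C=ρ^{M-n_0}/c_0 gives g(ρ)=0, so g[A] is not positive definite. *)

theory Defs
  imports "HOL-Analysis.Complex_Transcendental" "Jordan_Normal_Form.DL_Rank"
begin

unbundle no vec_syntax

text \<open>
  The order on the complex numbers is the one of \<open>HOL-Library.Complex_Order\<close>, so \<open>0 \<le> z\<close> says
  that \<open>z\<close> is real and non-negative. The quadratic form \<open>(A *\<^sub>v x) \<bullet>c x\<close> is \<open>x\<^sup>* A x\<close>. Ranging over
  all complex vectors, the conditions below force \<open>A\<close> to be Hermitian.
\<close>

definition pos_semidef :: "nat \<Rightarrow> complex mat \<Rightarrow> bool" where
  "pos_semidef N A \<longleftrightarrow>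
     A \<in> carrier_mat N N \<and> (\<forall>x\<in>carrier_vec N. 0 \<le> (A *\<^sub>v x) \<bullet>c x)"

definition pos_def :: "nat \<Rightarrow> complex mat \<Rightarrow> bool" where
  "pos_def N A \<longleftrightarrow>
     A \<in> carrier_mat N N \<and> (\<forall>x\<in>carrier_vec N. x \<noteq> 0\<^sub>v N \<longrightarrow> 0 < (A *\<^sub>v x) \<bullet>c x)"

definition loewner_le :: "nat \<Rightarrow> complex mat \<Rightarrow> complex mat \<Rightarrow> bool" where
  "loewner_le N B A \<longleftrightarrow> pos_semidef N (A - B)"

definition psd_mats :: "nat \<Rightarrow> nat \<Rightarrow> complex set \<Rightarrow> complex mat set" where
  "psd_mats N k I = {A. pos_semidef N A \<and> elements_mat A \<subseteq> I \<and> vec_space.rank N A \<le> k}"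

definition outer_self :: "complex vec \<Rightarrow> complex mat" where
  "outer_self u = mat (dim_vec u) (dim_vec u) (\<lambda>(i, j). u $ i * conjugate (u $ j))"

text \<open>
  In the library \<open>0 powr 0 = 0\<close>, whereas here \<open>0\<^sup>0 = 1\<close>. On positive reals the principal
  branch agrees with the real power.
\<close>

definition cpow :: "complex \<Rightarrow> real \<Rightarrow> complex" where
  "cpow z a = (if z = 0 \<and> a = 0 then 1 else z powr of_real a)"

definition vdm :: "real list \<Rightarrow> real" where
  "vdm m = (\<Prod>l<length m. \<Prod>k<l. m ! l - m ! k)"

definition exps :: "nat \<Rightarrow> (nat \<Rightarrow> real) \<Rightarrow> real list" where
  "exps N n = map n [0..<N]"

definition exps_omit :: "nat \<Rightarrow> (nat \<Rightarrow> real) \<Rightarrow> real \<Rightarrow> nat \<Rightarrow> real list" where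
  "exps_omit N n M j = map n ([0..<j] @ [Suc j..<N]) @ [M]"

definition sharp_const ::
  "nat \<Rightarrow> real \<Rightarrow> (nat \<Rightarrow> real) \<Rightarrow> real \<Rightarrow> (nat \<Rightarrow> real) \<Rightarrow> real" where
  "sharp_const N \<rho> n M c =
     (\<Sum>j<N. (vdm (exps_omit N n M j))\<^sup>2 / (vdm (exps N n))\<^sup>2 * (\<rho> powr (M - n j) / c j))"

definition has_zero_row :: "nat \<Rightarrow> complex mat \<Rightarrow> bool" where
  "has_zero_row N A \<longleftrightarrow> (\<exists>i<N. row A i = 0\<^sub>v N)"

definition admissible ::
  "nat \<Rightarrow> real \<Rightarrow> (nat \<Rightarrow> real) \<Rightarrow> real \<Rightarrow> complex mat set \<Rightarrow> bool" where
  "admissible N \<rho> n M P0 \<longleftrightarrow>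
     P0 = psd_mats N 1 (of_real ` {0<..<\<rho>})
   \<or> psd_mats N 1 (of_real ` {0<..<\<rho>}) \<subseteq> P0 \<and> P0 \<subseteq> psd_mats N 1 (of_real ` {0..\<rho>})
     \<and> n ` {..<N} \<union> {M} \<subseteq> {0..}
   \<or> psd_mats N 1 (of_real ` {0<..<\<rho>}) \<subseteq> P0 \<and> P0 \<subseteq> psd_mats N N (of_real ` {0..\<rho>})
     \<and> n ` {..<N} \<union> {M} \<subseteq> \<nat> \<union> {real N - 1..}"

end

theory Submission
  imports Defs "Jordan_Normal_Form.DL_Rank_Submatrix"
begin

text \<open>
  Write \<open>h(z) = \<Sum>\<^sub>j c\<^sub>j z^{n\<^sub>j}\<close> and let \<open>A = u u\<^sup>T\<close> have rank one with distinct \<open>u\<^sub>i > 0\<close>. Then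
  \<open>y\<^sup>T h[A] y = \<Sum>\<^sub>j c\<^sub>j Y\<^sub>j\<^sup>2\<close> with \<open>Y\<^sub>j = \<Sum>\<^sub>i y\<^sub>i u\<^sub>i^{n\<^sub>j}\<close>. Interpolating \<open>x^M\<close> at the points \<open>u\<^sub>i\<close>
  by \<open>\<Sum>\<^sub>j w\<^sub>j x^{n\<^sub>j}\<close> turns \<open>\<Sum>\<^sub>i y\<^sub>i u\<^sub>i^M\<close> into \<open>\<Sum>\<^sub>j w\<^sub>j Y\<^sub>j\<close>, and Cauchy-Schwarz bounds its square by
  \<open>(\<Sum>\<^sub>j w\<^sub>j\<^sup>2 / c\<^sub>j) (y\<^sup>T h[A] y)\<close>. So everything about rank one rests on bounding the interpolation
  coefficients: \<open>\<bar>w\<^sub>j\<bar> \<le> R^{M - n\<^sub>j} \<Prod>\<^sub>i \<bar>M - n\<^sub>i\<bar> / \<bar>n\<^sub>j - n\<^sub>i\<bar>\<close> when all points lie in \<open>(0, R]\<close>. Its right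
  side is the coefficient for the point \<open>R\<close> taken \<open>N\<close> times, and with \<open>R = \<surd>\<rho>\<close> it sums up to exactly
  the sharp constant. The bound (lemma \<open>interpolation_coeff_less\<close>) is an induction by Rolle's theorem: divide the
  interpolation error by \<open>x^{n\<^sub>k}\<close> for some \<open>k \<noteq> j\<close> and differentiate. The term \<open>k\<close> disappears, one zero
  is lost, all differences of exponents are kept, and the new zeros lie strictly below \<open>R\<close>. This
  is also the source of all strictness: for \<open>N \<ge> 2\<close> the bound is strict even if \<open>R\<close> is one of the
  points, so equality can only occur for \<open>N = 1\<close> and \<open>u = \<surd>\<rho>\<close>, or for the zero matrix.

  For a general positive semidefinite \<open>A\<close>, let \<open>u\<close> be its column \<open>s\<close> divided by \<open>\<surd>a\<^sub>s\<^sub>s\<close>. Then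
  \<open>A - u u\<^sup>T\<close> is positive semidefinite and vanishes in row and column \<open>s\<close>. Along the segment from
  \<open>u u\<^sup>T\<close> to \<open>A\<close> the derivative of \<open>F[\<cdot>]\<close> is the Hadamard product of \<open>A - u u\<^sup>T\<close> and \<open>F'[\<cdot>]\<close>, so by the
  Schur product theorem \<open>F[A] \<ge> F[u u\<^sup>T]\<close> as soon as \<open>F'\<close> preserves positivity in dimension \<open>N - 1\<close>
  (\<open>qform_entrywise_mono\<close>). Induction on the dimension then gives the theorem of FitzGerald and Horn
  on entrywise powers (\<open>psd_on_rpow\<close>, \<open>qform_rpow_mono\<close>) and, for
  \<open>F(z) = h(z) - \<C>^{-1} z^M\<close>, the comparison \<open>g[A] \<ge> g[u u\<^sup>T]\<close> (\<open>critical_fun_deflation_mono\<close>). Dropping the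
  lowest exponent from \<open>F'\<close> is harmless because the constant in dimension \<open>N - 1\<close> is then small enough.

  The theorem follows from these two parts. A row with distinct entries makes \<open>u\<close> distinct, hence
  \<open>g[A] \<ge> g[u u\<^sup>T] > 0\<close> unless \<open>N = 1\<close> and \<open>A = \<rho>\<close>. If all rows of \<open>A\<close> are distinct, a generic positive \<open>x\<close> makes the entries of \<open>A x\<close>
  distinct, a multiple \<open>u\<close> of \<open>A x\<close> satisfies \<open>A \<ge> u u\<^sup>T\<close>, and monotonicity of entrywise powers
  yields \<open>h[A] \<ge> h[u u\<^sup>T] > 0\<close>. For matrices of rank one with
  arbitrary real exponents the comparison is an equality: there \<open>A = v v\<^sup>T\<close> with \<open>v \<ge> 0\<close>, and \<open>v\<close> has
  distinct entries in both situations. Conversely, equal rows \<open>p\<close> and \<open>q\<close> put \<open>e\<^sub>p - e\<^sub>q\<close> into the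
  kernel. Finally \<open>f[A]\<close> and \<open>h[A]\<close> are definite together because \<open>0 \<le> A^{\<circ>M} \<le> \<C> h[A]\<close>. Since all
  matrices have non-negative real entries, the work is done with real quadratic forms over finite
  index sets, which makes passing to submatrices easy.
\<close>

section \<open>Interpolation by generalized polynomials\<close>

text \<open>
  Rolle's theorem between consecutive zeros. The strict bound \<open>y < R\<close> is what later turns a
  non-strict coefficient bound into a strict one.
\<close>

lemma finite_zero_set_derivative:
  fixes f f' :: "real \<Rightarrow> real"
  assumes fin: "finite X" and ne: "X \<noteq> {}"
    and X: "\<And>x. x \<in> X \<Longrightarrow> 0 < x \<and> x \<le> R \<and> f x = 0"
    and der: "\<And>x. 0 < x \<Longrightarrow> (f has_real_derivative f' x) (at x)"
  shows "\<exists>Y. finite Y \<and> card Y = card X - 1 \<and> (\<forall>y\<in>Y. 0 < y \<and> y < R \<and> f' y = 0)"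
proof -
  define L where "L = X - {Max X}"
  define nxt where "nxt x = Min {z \<in> X. x < z}" for x
  have nxt: "nxt x \<in> X \<and> x < nxt x \<and> (\<forall>z\<in>X. x < z \<longrightarrow> nxt x \<le> z)" if "x \<in> L" for x
  proof -
    have "x < Max X"
      using that fin Max_ge[OF fin, of x] by (auto simp: L_def less_le)
    then have "{z \<in> X. x < z} \<noteq> {}"
      using Max_in[OF fin ne] by auto
    then have "nxt x \<in> {z \<in> X. x < z}"
      unfolding nxt_def using fin by (intro Min_in) auto
    then show ?thesis
      using fin by (auto simp: nxt_def)
  qed
  have "\<exists>y. x < y \<and> y < nxt x \<and> f' y = 0" if "x \<in> L" for x
  proof -
    have x: "x \<in> X" "nxt x \<in> X" "x < nxt x"
      using that nxt[OF that] by (auto simp: L_def)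
    have "continuous_on {x..nxt x} f"
      using X[OF x(1)] by (intro continuous_at_imp_continuous_on ballI DERIV_isCont[OF der]) auto
    moreover have "(f has_derivative (*) (f' z)) (at z)" if "x < z" for z
      using der[of z] X[OF x(1)] that by (simp add: has_field_derivative_def)
    ultimately obtain z where "x < z" "z < nxt x" "(*) (f' z) = (\<lambda>v. 0)"
      using Rolle_deriv[of x "nxt x" f "\<lambda>z. (*) (f' z)"] X x by auto
    then show ?thesis
      by (metis mult.right_neutral)
  qed
  then obtain \<xi> where \<xi>: "\<And>x. x \<in> L \<Longrightarrow> x < \<xi> x \<and> \<xi> x < nxt x \<and> f' (\<xi> x) = 0"
    by metis
  \<comment> \<open>Distinct gaps between zeros are disjoint, so no Rolle point is counted twice.\<close>
  have "\<xi> x < \<xi> z" if "x \<in> L" "z \<in> L" "x < z" for x z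
    using \<xi>[OF that(1)] \<xi>[OF that(2)] nxt[OF that(1)] that by (force simp: L_def)
  then have "inj_on \<xi> L"
    by (intro linorder_inj_onI) (auto simp: less_le)
  then have "card (\<xi> ` L) = card X - 1"
    using fin ne by (simp add: card_image L_def)
  moreover have "0 < y \<and> y < R \<and> f' y = 0" if y: "y \<in> \<xi> ` L" for y
  proof -
    obtain x where x: "x \<in> L" "y = \<xi> x"
      using y by blast
    then show ?thesis
      using \<xi>[of x] nxt[of x] X[of x] X[of "nxt x"] by (auto simp: L_def)
  qed
  ultimately show ?thesis
    using fin by (intro exI[of _ "\<xi> ` L"]) (auto simp: L_def)
qed

lemma gen_poly_shift:
  fixes x :: real
  shows "(\<Sum>j\<in>J. a j * x powr (n j - p)) = (\<Sum>j\<in>J. a j * x powr n j) / x powr p"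
  by (simp add: powr_diff sum_divide_distrib)

lemma gen_poly_has_derivative:
  fixes x :: real
  assumes "finite J" "k \<in> J" "0 < x"
  shows "((\<lambda>x. \<Sum>j\<in>J. a j * x powr (n j - n k)) has_real_derivative
           (\<Sum>j\<in>J - {k}. a j * (n j - n k) * x powr (n j - n k - 1))) (at x)"
proof -
  have "((\<lambda>x. \<Sum>j\<in>J. a j * x powr (n j - n k)) has_real_derivative
           (\<Sum>j\<in>J. a j * ((n j - n k) * x powr (n j - n k - 1)))) (at x)"
    using assms by (intro DERIV_sum DERIV_cmult has_real_derivative_powr) auto
  also have "(\<Sum>j\<in>J. a j * ((n j - n k) * x powr (n j - n k - 1)))
      = (\<Sum>j\<in>J - {k}. a j * (n j - n k) * x powr (n j - n k - 1))"
    using assms by (simp add: sum.remove[of J k] mult.assoc)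
  finally show ?thesis .
qed

text \<open>
  Descartes' rule without signs: dividing by one of the monomials and differentiating removes a term
  at the cost of one zero, so the monomials \<open>x^{n\<^sub>j}\<close> form a Chebyshev system on the positive reals.
\<close>

lemma gen_poly_eq_0:
  fixes n a :: "'j \<Rightarrow> real"
  assumes "finite J" "inj_on n J" "finite X" "card X = card J" "X \<subseteq> {0<..}"
    and "\<And>x. x \<in> X \<Longrightarrow> (\<Sum>j\<in>J. a j * x powr n j) = 0"
  shows "\<forall>j\<in>J. a j = 0"
  using assms
proof (induction "card J" arbitrary: J a n X)
  case 0
  then show ?case by simp
next
  case (Suc m)
  then obtain k where k: "k \<in> J"
    by (metis card.empty equals0I nat.distinct(1))
  have Xne: "X \<noteq> {}"
    using Suc by auto
  define R where "R = Max X"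
  have zero: "0 < x \<and> x \<le> R \<and> (\<Sum>j\<in>J. a j * x powr (n j - n k)) = 0" if "x \<in> X" for x
    using Suc.prems(3,5) Suc.prems(6)[OF that] that by (auto simp: R_def gen_poly_shift)
  obtain Y where Y: "finite Y" "card Y = card X - 1"
    "\<And>y. y \<in> Y \<Longrightarrow> 0 < y \<and> y < R
       \<and> (\<Sum>j\<in>J - {k}. a j * (n j - n k) * y powr (n j - n k - 1)) = 0"
    using finite_zero_set_derivative[OF Suc.prems(3) Xne zero
        gen_poly_has_derivative[OF Suc.prems(1) k]] by blast
  have "\<forall>j\<in>J - {k}. a j * (n j - n k) = 0"
  proof (rule Suc.hyps(1)[where n = "\<lambda>j. n j - n k - 1"])
    show "m = card (J - {k})" "card Y = card (J - {k})"
      using Suc k Y by auto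
    show "inj_on (\<lambda>j. n j - n k - 1) (J - {k})"
      using Suc.prems(2) by (auto simp: inj_on_def)
  qed (use Suc.prems Y in auto)
  then have J: "\<forall>j\<in>J - {k}. a j = 0"
    using Suc.prems(2) k by (auto simp: inj_on_def)
  obtain x where x: "x \<in> X"
    using Xne by auto
  then have "(\<Sum>j\<in>J. a j * x powr n j) = a k * x powr n k"
    using Suc.prems(1) k J by (simp add: sum.remove[of J k])
  then have "a k = 0"
    using Suc.prems(5,6) x by force
  then show ?case
    using J by auto
qed

text \<open>
  One point and one monomial are added at a time, as in Newton interpolation. The new basis
  function \<open>x^{n\<^sub>k} - \<Sum>\<^sub>j v\<^sub>j x^{n\<^sub>j}\<close> vanishes at the old points, and by uniqueness it does not vanish
  at the new one.
\<close>

lemma gen_poly_interpolation: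
  fixes n :: "'j \<Rightarrow> real" and \<phi> :: "real \<Rightarrow> real"
  assumes "finite J" "inj_on n J" "finite X" "card X = card J" "X \<subseteq> {0<..}"
  shows "\<exists>w. \<forall>x\<in>X. (\<Sum>j\<in>J. w j * x powr n j) = \<phi> x"
  using assms
proof (induction J arbitrary: X \<phi> rule: finite_induct)
  case empty
  then show ?case by auto
next
  case (insert k J)
  then obtain x0 where x0: "x0 \<in> X"
    by fastforce
  have X': "finite (X - {x0})" "card (X - {x0}) = card J" "X - {x0} \<subseteq> {0<..}" "inj_on n J"
    using insert x0 by (auto simp: card_Diff_singleton)
  obtain w where w: "\<forall>x\<in>X - {x0}. (\<Sum>j\<in>J. w j * x powr n j) = \<phi> x"
    using insert.IH[of "X - {x0}" \<phi>] X' by auto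
  obtain v where v: "\<forall>x\<in>X - {x0}. (\<Sum>j\<in>J. v j * x powr n j) = x powr n k"
    using insert.IH[of "X - {x0}" "\<lambda>x. x powr n k"] X' by auto
  define r where "r = x0 powr n k - (\<Sum>j\<in>J. v j * x0 powr n j)"
  have ins: "(\<Sum>j\<in>insert k J. (if j = k then s else u j) * x powr n j)
      = s * x powr n k + (\<Sum>j\<in>J. u j * x powr n j)" for s u x
    using insert.hyps by (auto intro!: sum.cong)
  have "r \<noteq> 0"
  proof
    assume r: "r = 0"
    have "(\<Sum>j\<in>insert k J. (if j = k then 1 else - v j) * x powr n j) = 0" if "x \<in> X" for x
      unfolding ins using v r that by (cases "x = x0") (auto simp: r_def sum_negf)
    then have "\<forall>j\<in>insert k J. (if j = k then 1 else - v j) = 0"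
      by (intro gen_poly_eq_0[where X = X]) (use insert in auto)
    then show False by auto
  qed
  define s where "s = (\<phi> x0 - (\<Sum>j\<in>J. w j * x0 powr n j)) / r"
  have lin: "(\<Sum>j\<in>insert k J. (if j = k then s else w j - s * v j) * x powr n j)
      = (\<Sum>j\<in>J. w j * x powr n j) + s * (x powr n k - (\<Sum>j\<in>J. v j * x powr n j))" for x
    unfolding ins by (simp add: algebra_simps sum_subtractf sum_distrib_left)
  have "(\<Sum>j\<in>insert k J. (if j = k then s else w j - s * v j) * x powr n j) = \<phi> x" if "x \<in> X" for x
    unfolding lin using w v that \<open>r \<noteq> 0\<close> by (cases "x = x0") (auto simp: s_def r_def[symmetric])
  then show ?case
    by (intro exI[of _ "\<lambda>j. if j = k then s else w j - s * v j"] ballI)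
qed

text \<open>
  The absolute value of the \<open>j\<close>th coefficient of the generalized polynomial that agrees with \<open>x^M\<close> to
  order \<open>card J\<close> at \<open>R\<close>: with \<open>x = R e^t\<close> this confluent problem becomes Lagrange interpolation at the
  nodes \<open>n\<^sub>i\<close>, evaluated at \<open>M\<close>.
\<close>

definition coeff_bound :: "'j set \<Rightarrow> ('j \<Rightarrow> real) \<Rightarrow> real \<Rightarrow> real \<Rightarrow> 'j \<Rightarrow> real" where
  "coeff_bound J n M R j = R powr (M - n j) * (\<Prod>i\<in>J - {j}. \<bar>M - n i\<bar> / \<bar>n j - n i\<bar>)"

lemma coeff_bound_remove:
  assumes "finite J" "k \<in> J" "k \<noteq> j"
  shows "coeff_bound J n M R j = coeff_bound (J - {k}) n M R j * (\<bar>M - n k\<bar> / \<bar>n j - n k\<bar>)"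
proof -
  have "J - {j} - {k} = J - {k} - {j}" by auto
  then show ?thesis
    using assms by (simp add: coeff_bound_def prod.remove[of "J - {j}" k])
qed

lemma coeff_bound_shift:
  "coeff_bound J (\<lambda>i. n i - p) (M - p) R j = coeff_bound J n M R j"
  by (simp add: coeff_bound_def)

text \<open>
  The analytic core. Dividing the error \<open>x^M - \<Sum>\<^sub>i w\<^sub>i x^{n\<^sub>i}\<close> by \<open>x^{n\<^sub>k}\<close>, \<open>k \<noteq> j\<close>, and differentiating gives
  an interpolation problem with one term and one point less, whose coefficients are
  \<open>w\<^sub>i (n\<^sub>i - n\<^sub>k) / (M - n\<^sub>k)\<close>. The bound scales by the same factor, and the new points are
  smaller than \<open>R\<close>.
\<close>

lemma interpolation_coeff_less:
  fixes n w :: "'j \<Rightarrow> real"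
  assumes "finite J" "j \<in> J" "inj_on n J" "\<And>i. i \<in> J \<Longrightarrow> n i < M"
    and "finite X" "card X = card J" "X \<subseteq> {0<..R}" "card J \<ge> 2 \<or> R \<notin> X"
    and "\<And>x. x \<in> X \<Longrightarrow> x powr M = (\<Sum>i\<in>J. w i * x powr n i)"
  shows "\<bar>w j\<bar> < coeff_bound J n M R j"
  using assms
proof (induction "card J" arbitrary: J n w M X)
  case 0
  show ?case
    using 0(1-3) by (auto simp: card_eq_0_iff)
next
  case (Suc m)
  show ?case
  proof (cases "m = 0")
    case True
    have J: "J = {j}"
      using Suc.hyps(2) Suc.prems(1,2) True by (metis One_nat_def card_1_singletonE singletonD)
    obtain x where x: "X = {x}"
      using Suc.hyps(2) Suc.prems(6) True by (metis One_nat_def card_1_singletonE)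
    have xR: "0 < x" "x < R"
      using Suc.prems(7,8) x J by auto
    have "w j = x powr (M - n j)"
      using Suc.prems(9)[of x] x J xR by (simp add: powr_diff)
    then show ?thesis
      using Suc.prems(4)[of j] J xR by (simp add: coeff_bound_def powr_less_mono2)
  next
    case False
    have "card (J - {j}) \<noteq> 0"
      using Suc.hyps(2) Suc.prems(1,2) False by simp
    then obtain k where k: "k \<in> J" "k \<noteq> j"
      by (metis Diff_iff all_not_in_conv card.empty singletonI)
    have Xne: "X \<noteq> {}"
      using Suc.hyps(2) Suc.prems(6) by force
    have Mk: "M - n k > 0" and njk: "n j \<noteq> n k"
      using Suc.prems(2-4) k by (auto simp: inj_on_def)
    have zero: "0 < x \<and> x \<le> R \<and> x powr (M - n k) - (\<Sum>i\<in>J. w i * x powr (n i - n k)) = 0"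
      if "x \<in> X" for x
      using Suc.prems(7) Suc.prems(9)[OF that] that by (auto simp: gen_poly_shift powr_diff[of x M])
    have der: "((\<lambda>x. x powr (M - n k) - (\<Sum>i\<in>J. w i * x powr (n i - n k))) has_real_derivative
        (M - n k) * x powr (M - n k - 1)
          - (\<Sum>i\<in>J - {k}. w i * (n i - n k) * x powr (n i - n k - 1))) (at x)" if "0 < x" for x
      by (intro DERIV_diff has_real_derivative_powr gen_poly_has_derivative Suc.prems(1) k that)
    obtain Y where Y: "finite Y" "card Y = card X - 1"
      "\<And>y. y \<in> Y \<Longrightarrow> 0 < y \<and> y < R \<and> (M - n k) * y powr (M - n k - 1)
          - (\<Sum>i\<in>J - {k}. w i * (n i - n k) * y powr (n i - n k - 1)) = 0"
      using finite_zero_set_derivative[OF Suc.prems(5) Xne zero der] by blast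
    have "\<bar>w j * (n j - n k) / (M - n k)\<bar>
        < coeff_bound (J - {k}) (\<lambda>i. n i - n k - 1) (M - n k - 1) R j"
    proof (rule Suc.hyps(1)[where X = Y and w = "\<lambda>i. w i * (n i - n k) / (M - n k)"])
      show "m = card (J - {k})" "card Y = card (J - {k})"
        using Suc.hyps(2) Suc.prems(1,6) k Y(2) by auto
      show "inj_on (\<lambda>j. n j - n k - 1) (J - {k})"
        using Suc.prems(3) by (auto simp: inj_on_def)
      show "y powr (M - n k - 1)
          = (\<Sum>i\<in>J - {k}. w i * (n i - n k) / (M - n k) * y powr (n i - n k - 1))" if "y \<in> Y" for y
        using Y(3)[OF that] Mk by (simp add: sum_divide_distrib[symmetric] field_simps)
    qed (use Suc.prems(1,2,4) Y(1,3) k in \<open>auto simp: less_imp_le\<close>)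
    also have "\<dots> = coeff_bound (J - {k}) n M R j"
      using coeff_bound_shift[of "J - {k}" n "n k + 1" M R j] by (simp add: algebra_simps)
    finally have "\<bar>w j\<bar> * \<bar>n j - n k\<bar> / \<bar>M - n k\<bar> < coeff_bound (J - {k}) n M R j"
      by (simp add: abs_mult)
    then have "\<bar>w j\<bar> < coeff_bound (J - {k}) n M R j * (\<bar>M - n k\<bar> / \<bar>n j - n k\<bar>)"
      using Mk njk by (simp add: field_simps)
    then show ?thesis
      using coeff_bound_remove[OF Suc.prems(1) k] by simp
  qed
qed

definition rpow :: "real \<Rightarrow> real \<Rightarrow> real" where
  "rpow z a = (if a = 0 then 1 else z powr a)"

lemma rpow_pos: "0 < z \<Longrightarrow> rpow z a = z powr a"
  by (simp add: rpow_def)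

lemma rpow_zero: "rpow 0 a = (if a = 0 then 1 else 0)"
  by (simp add: rpow_def)

lemma rpow_nonneg: "0 \<le> rpow z a"
  by (simp add: rpow_def)

lemma rpow_mult: "rpow (x * y) a = rpow x a * rpow y a"
  by (simp add: rpow_def powr_mult)

text \<open>
  At the point 0 all monomials vanish except the constant one, so its coefficient is
  prescribed and the others solve the problem at the positive points.
\<close>

lemma rpow_interpolation:
  fixes n :: "'j \<Rightarrow> real" and \<phi> :: "real \<Rightarrow> real"
  assumes J: "finite J" "inj_on n J" and X: "finite X" "card X = card J" "X \<subseteq> {0..}"
    and zero: "0 \<in> X \<Longrightarrow> 0 \<in> n ` J"
  shows "\<exists>w. \<forall>x\<in>X. (\<Sum>j\<in>J. w j * rpow x (n j)) = \<phi> x"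
proof (cases "0 \<in> X")
  case False
  then have "X \<subseteq> {0<..}"
    using X(3) by (force simp: less_le)
  then show ?thesis
    using gen_poly_interpolation[OF J X(1,2), of \<phi>] by (fastforce simp: rpow_pos)
next
  case True
  then obtain k where k: "k \<in> J" "n k = 0"
    using zero by force
  have nz: "n j \<noteq> 0" if "j \<in> J - {k}" for j
    using J(2) k that by (metis DiffE inj_onD singletonI)
  have X': "X - {0} \<subseteq> {0<..}"
    using X(3) by (force simp: less_le)
  obtain w where w: "\<forall>x\<in>X - {0}. (\<Sum>j\<in>J - {k}. w j * x powr n j) = \<phi> x - \<phi> 0"
    using gen_poly_interpolation[of "J - {k}" n "X - {0}" "\<lambda>x. \<phi> x - \<phi> 0"] J X k True X'
    by (auto simp: inj_on_diff)
  define v where "v = w(k := \<phi> 0)"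
  have "(\<Sum>j\<in>J. v j * rpow x (n j)) = \<phi> 0 + (\<Sum>j\<in>J - {k}. w j * rpow x (n j))" for x
    using J k by (simp add: sum.remove[of J k] v_def rpow_def)
  moreover have "(\<Sum>j\<in>J - {k}. w j * rpow 0 (n j)) = 0"
    using nz by (intro sum.neutral) (auto simp: rpow_zero)
  moreover have "(\<Sum>j\<in>J - {k}. w j * rpow x (n j)) = \<phi> x - \<phi> 0" if "x \<in> X - {0}" for x
    using w that X' by (auto simp: rpow_pos subset_eq)
  ultimately show ?thesis
    by (intro exI[of _ v]) (metis DiffI add.right_neutral add_diff_cancel_left' diff_add_cancel
        add.commute singletonD)
qed

lemma coeff_bound_pos:
  assumes "0 < R" "inj_on n J" "j \<in> J" "\<And>i. i \<in> J \<Longrightarrow> n i < M"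
  shows "0 < coeff_bound J n M R j"
proof -
  have "0 < \<bar>M - n i\<bar> / \<bar>n j - n i\<bar>" if "i \<in> J - {j}" for i
  proof -
    have "n j \<noteq> n i" "n i < M"
      using assms(2,3) assms(4)[of i] that by (auto simp: inj_on_def)
    then show ?thesis by simp
  qed
  then show ?thesis
    using assms(1) by (auto simp: coeff_bound_def intro!: mult_pos_pos prod_pos)
qed

lemma interpolation_coeff_le:
  fixes n w :: "'j \<Rightarrow> real"
  assumes "finite J" "j \<in> J" "inj_on n J" "\<And>i. i \<in> J \<Longrightarrow> n i < M"
    and "finite X" "card X = card J" "X \<subseteq> {0<..R}"
    and eq: "\<And>x. x \<in> X \<Longrightarrow> x powr M = (\<Sum>i\<in>J. w i * x powr n i)"
  shows "\<bar>w j\<bar> \<le> coeff_bound J n M R j"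
proof (cases "card J \<ge> 2 \<or> R \<notin> X")
  case True
  then show ?thesis
    using interpolation_coeff_less[OF assms(1-7) True eq] by simp
next
  case False
  moreover have "card J \<noteq> 0"
    using assms(1,2) by auto
  ultimately have "card J = 1"
    by linarith
  then have J: "J = {j}" and "X = {R}"
    using assms(2,6) False by (auto simp: card_1_singleton_iff)
  then have "w j = R powr (M - n j)" "0 < R"
    using eq[of R] assms(7) by (auto simp: powr_diff)
  then show ?thesis
    by (simp add: coeff_bound_def J)
qed

text \<open>
  If 0 is a point, the constant term has coefficient 0 and can be dropped together with that point.
  This loses the factor \<open>M / n\<^sub>j > 1\<close> of the bound, so strictness is automatic.
\<close>

lemma rpow_interpolation_coeff_less:
  fixes n w :: "'j \<Rightarrow> real"
  assumes J: "finite J" "j \<in> J" "inj_on n J" "\<And>i. i \<in> J \<Longrightarrow> n i < M" and R: "0 < R"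
    and X: "finite X" "card X = card J" "X \<subseteq> {0..R}" "card J \<ge> 2 \<or> R \<notin> X"
    and zero: "0 \<in> X \<Longrightarrow> 0 \<in> n ` J \<and> (\<forall>i\<in>J. 0 \<le> n i)"
    and eq: "\<And>x. x \<in> X \<Longrightarrow> rpow x M = (\<Sum>i\<in>J. w i * rpow x (n i))"
  shows "\<bar>w j\<bar> < coeff_bound J n M R j"
proof (cases "0 \<in> X")
  case False
  then have X': "X \<subseteq> {0<..R}"
    using X(3) by (force simp: less_le)
  show ?thesis
    by (rule interpolation_coeff_less[OF J X(1,2) X' X(4)])
      (use eq X' in \<open>auto simp: rpow_pos subset_eq\<close>)
next
  case True
  obtain k where k: "k \<in> J" "n k = 0"
    using zero[OF True] by force
  have M: "0 < M"
    using J(4) k by force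
  have pos: "0 < n i" if "i \<in> J - {k}" for i
    using zero[OF True] J(3) k that by (metis DiffE inj_onD insertCI order_le_less)
  have "w i * rpow 0 (n i) = 0" if "i \<in> J - {k}" for i
    using pos[OF that] by (simp add: rpow_zero)
  then have "(\<Sum>i\<in>J - {k}. w i * rpow 0 (n i)) = 0"
    by (intro sum.neutral) blast
  then have wk: "w k = 0"
    using eq[OF True] M k J(1) by (simp add: sum.remove[of J k] rpow_zero)
  show ?thesis
  proof (cases "j = k")
    case True
    then show ?thesis
      using wk coeff_bound_pos[OF R J(3,2,4)] by simp
  next
    case False
    have X': "X - {0} \<subseteq> {0<..R}"
      using X(3) by (force simp: less_le)
    have "\<bar>w j\<bar> \<le> coeff_bound (J - {k}) n M R j"
    proof (rule interpolation_coeff_le)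
      show "x powr M = (\<Sum>i\<in>J - {k}. w i * x powr n i)" if "x \<in> X - {0}" for x
        using eq[of x] that X' wk k J(1) by (auto simp: sum.remove[of J k] rpow_pos subset_eq)
    qed (use J X X' k False True in \<open>auto simp: inj_on_diff\<close>)
    also have "\<dots> < coeff_bound (J - {k}) n M R j * (\<bar>M - n k\<bar> / \<bar>n j - n k\<bar>)"
    proof -
      have "0 < coeff_bound (J - {k}) n M R j"
        using J False by (intro coeff_bound_pos[OF R]) (auto simp: inj_on_diff)
      moreover have "1 < \<bar>M - n k\<bar> / \<bar>n j - n k\<bar>"
        using pos[of j] J(2) J(4)[OF J(2)] k(2) False by simp
      ultimately show ?thesis
        using mult_strict_left_mono[of 1] by fastforce
    qed
    also have "\<dots> = coeff_bound J n M R j"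
      using coeff_bound_remove[of J k j n M R] J k False by simp
    finally show ?thesis .
  qed
qed

lemma rpow_interpolation_coeff_le:
  fixes n w :: "'j \<Rightarrow> real"
  assumes J: "finite J" "j \<in> J" "inj_on n J" "\<And>i. i \<in> J \<Longrightarrow> n i < M" and R: "0 < R"
    and X: "finite X" "card X = card J" "X \<subseteq> {0..R}"
    and zero: "0 \<in> X \<Longrightarrow> 0 \<in> n ` J \<and> (\<forall>i\<in>J. 0 \<le> n i)"
    and eq: "\<And>x. x \<in> X \<Longrightarrow> rpow x M = (\<Sum>i\<in>J. w i * rpow x (n i))"
  shows "\<bar>w j\<bar> \<le> coeff_bound J n M R j"
proof (cases "0 \<in> X")
  case True
  have "R \<notin> X" if "\<not> card J \<ge> 2"
  proof
    assume "R \<in> X"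
    then have "card {0, R} \<le> card X"
      using True X(1) by (intro card_mono) auto
    then show False
      using that R X(2) by simp
  qed
  then show ?thesis
    using rpow_interpolation_coeff_less[OF J R X _ zero eq] by fastforce
next
  case False
  then have X': "X \<subseteq> {0<..R}"
    using X(3) by (force simp: less_le)
  show ?thesis
    by (rule interpolation_coeff_le[OF J X(1,2) X'])
      (use eq X' in \<open>auto simp: rpow_pos subset_eq\<close>)
qed

section \<open>The sharp inequality for power sums\<close>

text \<open>
  The sum of the squared coefficient bounds at \<open>R = \<surd>\<rho>\<close>, weighted by \<open>1 / c\<^sub>j\<close>. In this form the constant makes
  sense for any finite set of exponents, which the induction on the dimension requires.
\<close>

definition sharp_bound :: "'j set \<Rightarrow> ('j \<Rightarrow> real) \<Rightarrow> real \<Rightarrow> real \<Rightarrow> ('j \<Rightarrow> real) \<Rightarrow> real" where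
  "sharp_bound J n M \<rho> c =
     (\<Sum>j\<in>J. (\<Prod>i\<in>J - {j}. ((M - n i) / (n j - n i))\<^sup>2) * \<rho> powr (M - n j) / c j)"

lemma coeff_bound_power2:
  assumes "0 < \<rho>"
  shows "(coeff_bound J n M (sqrt \<rho>) j)\<^sup>2
    = (\<Prod>i\<in>J - {j}. ((M - n i) / (n j - n i))\<^sup>2) * \<rho> powr (M - n j)"
proof -
  have "(sqrt \<rho> powr (M - n j))\<^sup>2 = \<rho> powr (M - n j)"
    using assms by (simp add: power2_eq_square powr_mult[symmetric])
  then show ?thesis
    by (simp add: coeff_bound_def power_mult_distrib prod_power_distrib power_divide)
qed

lemma weighted_Cauchy_Schwarz:
  fixes c w Y :: "'j \<Rightarrow> real"
  assumes "\<And>j. j \<in> J \<Longrightarrow> 0 < c j"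
  shows "(\<Sum>j\<in>J. w j * Y j)\<^sup>2 \<le> (\<Sum>j\<in>J. (w j)\<^sup>2 / c j) * (\<Sum>j\<in>J. c j * (Y j)\<^sup>2)"
proof -
  have "(\<Sum>j\<in>J. w j / sqrt (c j) * (sqrt (c j) * Y j)) = (\<Sum>j\<in>J. w j * Y j)"
    using assms by (intro sum.cong) fastforce+
  moreover have "(\<Sum>j\<in>J. (w j / sqrt (c j))\<^sup>2) = (\<Sum>j\<in>J. (w j)\<^sup>2 / c j)"
    "(\<Sum>j\<in>J. (sqrt (c j) * Y j)\<^sup>2) = (\<Sum>j\<in>J. c j * (Y j)\<^sup>2)"
    using assms by (auto intro!: sum.cong simp: power_divide power_mult_distrib less_imp_le)
  ultimately show ?thesis
    using Cauchy_Schwarz_ineq_sum[of "\<lambda>j. w j / sqrt (c j)" "\<lambda>j. sqrt (c j) * Y j" J] by simp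
qed

lemma sum_swap_interpolation:
  fixes y :: "real \<Rightarrow> real"
  assumes "\<And>x. x \<in> X \<Longrightarrow> \<phi> x = (\<Sum>j\<in>J. w j * rpow x (n j))"
  shows "(\<Sum>x\<in>X. y x * \<phi> x) = (\<Sum>j\<in>J. w j * (\<Sum>x\<in>X. y x * rpow x (n j)))"
proof -
  have "(\<Sum>x\<in>X. y x * \<phi> x) = (\<Sum>x\<in>X. \<Sum>j\<in>J. w j * (y x * rpow x (n j)))"
    using assms by (auto intro!: sum.cong simp: sum_distrib_left mult.left_commute)
  then show ?thesis
    by (simp add: sum.swap[of _ X] sum_distrib_left)
qed

text \<open>
  Dual to the solvability of interpolation: if all power sums vanished, then so would
  \<open>\<Sum>\<^sub>x y\<^sub>x \<phi>(x)\<close> for every \<open>\<phi>\<close>, in particular for the indicator function of \<open>z\<close>.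
\<close>

lemma power_sums_pos:
  fixes y :: "real \<Rightarrow> real"
  assumes J: "finite J" "inj_on n J" and X: "finite X" "card X = card J" "X \<subseteq> {0..}"
    and zero: "0 \<in> X \<Longrightarrow> 0 \<in> n ` J" and c: "\<And>j. j \<in> J \<Longrightarrow> 0 < c j"
    and z: "z \<in> X" "y z \<noteq> 0"
  shows "0 < (\<Sum>j\<in>J. c j * (\<Sum>x\<in>X. y x * rpow x (n j))\<^sup>2)"
proof -
  obtain w where w: "\<forall>x\<in>X. (\<Sum>j\<in>J. w j * rpow x (n j)) = (if x = z then 1 else 0)"
    using rpow_interpolation[OF J X zero, of "\<lambda>x. if x = z then 1 else 0"] by blast
  have "(\<Sum>x\<in>X. y x * (if x = z then 1 else 0)) = (\<Sum>j\<in>J. w j * (\<Sum>x\<in>X. y x * rpow x (n j)))"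
    using w by (intro sum_swap_interpolation) simp
  then have "(\<Sum>j\<in>J. w j * (\<Sum>x\<in>X. y x * rpow x (n j))) \<noteq> 0"
    using z X(1) by (simp add: if_distrib cong: if_cong)
  then obtain j where "j \<in> J" "w j * (\<Sum>x\<in>X. y x * rpow x (n j)) \<noteq> 0"
    by (rule sum.not_neutral_contains_not_neutral)
  then show ?thesis
    using c J by (intro sum_pos2[of J j]) (auto simp: less_imp_le)
qed

lemma power_sums_sq_less:
  fixes y :: "real \<Rightarrow> real" and n c :: "'j \<Rightarrow> real"
  assumes J: "finite J" "inj_on n J" "\<And>j. j \<in> J \<Longrightarrow> n j < M" "\<And>j. j \<in> J \<Longrightarrow> 0 < c j"
    and \<rho>: "0 < \<rho>"
    and X: "finite X" "card X = card J" "X \<subseteq> {0..sqrt \<rho>}" "card J \<ge> 2 \<or> sqrt \<rho> \<notin> X"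
    and zero: "0 \<in> X \<Longrightarrow> 0 \<in> n ` J \<and> (\<forall>i\<in>J. 0 \<le> n i)"
    and z: "z \<in> X" "y z \<noteq> 0"
  shows "(\<Sum>x\<in>X. y x * rpow x M)\<^sup>2
    < sharp_bound J n M \<rho> c * (\<Sum>j\<in>J. c j * (\<Sum>x\<in>X. y x * rpow x (n j))\<^sup>2)"
proof -
  have X0: "X \<subseteq> {0..}"
    using X(3) by auto
  have "0 \<in> X \<Longrightarrow> 0 \<in> n ` J"
    using zero by blast
  then obtain w where w: "\<And>x. x \<in> X \<Longrightarrow> rpow x M = (\<Sum>j\<in>J. w j * rpow x (n j))"
    using rpow_interpolation[OF J(1,2) X(1,2) X0, of "\<lambda>x. rpow x M"] by metis
  have "(w j)\<^sup>2 / c j < (\<Prod>i\<in>J - {j}. ((M - n i) / (n j - n i))\<^sup>2) * \<rho> powr (M - n j) / c j"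
    if "j \<in> J" for j
  proof -
    have "\<bar>w j\<bar> < coeff_bound J n M (sqrt \<rho>) j"
      using rpow_interpolation_coeff_less[OF J(1) that J(2,3) _ X zero w] \<rho> by simp
    then have "\<bar>w j\<bar>\<^sup>2 < (coeff_bound J n M (sqrt \<rho>) j)\<^sup>2"
      by (intro power_strict_mono) auto
    then show ?thesis
      using J(4)[OF that] by (simp add: coeff_bound_power2[OF \<rho>] divide_strict_right_mono)
  qed
  moreover have "J \<noteq> {}"
    using X z by auto
  ultimately have "(\<Sum>j\<in>J. (w j)\<^sup>2 / c j) < sharp_bound J n M \<rho> c"
    unfolding sharp_bound_def using J(1) by (intro sum_strict_mono) auto
  moreover have "0 < (\<Sum>j\<in>J. c j * (\<Sum>x\<in>X. y x * rpow x (n j))\<^sup>2)"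
    using zero by (intro power_sums_pos[of J n X c z y] J X X0 z) auto
  ultimately have bound: "(\<Sum>j\<in>J. (w j)\<^sup>2 / c j) * (\<Sum>j\<in>J. c j * (\<Sum>x\<in>X. y x * rpow x (n j))\<^sup>2)
      < sharp_bound J n M \<rho> c * (\<Sum>j\<in>J. c j * (\<Sum>x\<in>X. y x * rpow x (n j))\<^sup>2)"
    by (rule mult_strict_right_mono)
  have swap: "(\<Sum>x\<in>X. y x * rpow x M) = (\<Sum>j\<in>J. w j * (\<Sum>x\<in>X. y x * rpow x (n j)))"
    by (rule sum_swap_interpolation[OF w])
  have "(\<Sum>j\<in>J. w j * (\<Sum>x\<in>X. y x * rpow x (n j)))\<^sup>2
      \<le> (\<Sum>j\<in>J. (w j)\<^sup>2 / c j) * (\<Sum>j\<in>J. c j * (\<Sum>x\<in>X. y x * rpow x (n j))\<^sup>2)"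
    by (rule weighted_Cauchy_Schwarz[OF J(4)])
  then show ?thesis
    unfolding swap using bound by (rule le_less_trans)
qed

lemma power_sums_sq_le:
  fixes y :: "real \<Rightarrow> real" and n c :: "'j \<Rightarrow> real"
  assumes J: "finite J" "inj_on n J" "\<And>j. j \<in> J \<Longrightarrow> n j < M" "\<And>j. j \<in> J \<Longrightarrow> 0 < c j"
    and \<rho>: "0 < \<rho>"
    and X: "finite X" "card X = card J" "X \<subseteq> {0..sqrt \<rho>}"
    and zero: "0 \<in> X \<Longrightarrow> 0 \<in> n ` J \<and> (\<forall>i\<in>J. 0 \<le> n i)"
  shows "(\<Sum>x\<in>X. y x * rpow x M)\<^sup>2
    \<le> sharp_bound J n M \<rho> c * (\<Sum>j\<in>J. c j * (\<Sum>x\<in>X. y x * rpow x (n j))\<^sup>2)"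
proof -
  have X0: "X \<subseteq> {0..}"
    using X(3) by auto
  have "0 \<in> X \<Longrightarrow> 0 \<in> n ` J"
    using zero by blast
  then obtain w where w: "\<And>x. x \<in> X \<Longrightarrow> rpow x M = (\<Sum>j\<in>J. w j * rpow x (n j))"
    using rpow_interpolation[OF J(1,2) X(1,2) X0, of "\<lambda>x. rpow x M"] by metis
  have "(w j)\<^sup>2 / c j \<le> (\<Prod>i\<in>J - {j}. ((M - n i) / (n j - n i))\<^sup>2) * \<rho> powr (M - n j) / c j"
    if "j \<in> J" for j
  proof -
    have "\<bar>w j\<bar> \<le> coeff_bound J n M (sqrt \<rho>) j"
      using rpow_interpolation_coeff_le[OF J(1) that J(2,3) _ X zero w] \<rho> by simp
    then have "\<bar>w j\<bar>\<^sup>2 \<le> (coeff_bound J n M (sqrt \<rho>) j)\<^sup>2"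
      by (intro power_mono) auto
    then show ?thesis
      using J(4)[OF that] by (simp add: coeff_bound_power2[OF \<rho>] divide_right_mono)
  qed
  then have "(\<Sum>j\<in>J. (w j)\<^sup>2 / c j) \<le> sharp_bound J n M \<rho> c"
    unfolding sharp_bound_def by (intro sum_mono) auto
  moreover have "0 \<le> (\<Sum>j\<in>J. c j * (\<Sum>x\<in>X. y x * rpow x (n j))\<^sup>2)"
    using J(4) by (intro sum_nonneg) (auto simp: less_imp_le)
  ultimately have bound: "(\<Sum>j\<in>J. (w j)\<^sup>2 / c j) * (\<Sum>j\<in>J. c j * (\<Sum>x\<in>X. y x * rpow x (n j))\<^sup>2)
      \<le> sharp_bound J n M \<rho> c * (\<Sum>j\<in>J. c j * (\<Sum>x\<in>X. y x * rpow x (n j))\<^sup>2)"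
    by (rule mult_right_mono)
  have swap: "(\<Sum>x\<in>X. y x * rpow x M) = (\<Sum>j\<in>J. w j * (\<Sum>x\<in>X. y x * rpow x (n j)))"
    by (rule sum_swap_interpolation[OF w])
  have "(\<Sum>j\<in>J. w j * (\<Sum>x\<in>X. y x * rpow x (n j)))\<^sup>2
      \<le> (\<Sum>j\<in>J. (w j)\<^sup>2 / c j) * (\<Sum>j\<in>J. c j * (\<Sum>x\<in>X. y x * rpow x (n j))\<^sup>2)"
    by (rule weighted_Cauchy_Schwarz[OF J(4)])
  then show ?thesis
    unfolding swap using bound by (rule order_trans)
qed

lemma sum_over_image_points:
  fixes u y :: "'s \<Rightarrow> real"
  assumes "finite S" "finite X" "\<And>s. s \<in> S \<Longrightarrow> u s \<notin> X \<Longrightarrow> F (u s) = 0"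
  shows "(\<Sum>x\<in>X. (\<Sum>s | s \<in> S \<and> u s = x. y s) * F x) = (\<Sum>s\<in>S. y s * (F (u s) :: real))"
proof -
  have "(\<Sum>x\<in>X. (\<Sum>s | s \<in> S \<and> u s = x. y s) * F x)
      = (\<Sum>x\<in>X. \<Sum>s\<in>S. if u s = x then y s * F (u s) else 0)"
  proof (intro sum.cong refl)
    fix x
    have "(\<Sum>s | s \<in> S \<and> u s = x. y s) * F x = (\<Sum>s | s \<in> S \<and> u s = x. y s * F (u s))"
      by (simp add: sum_distrib_right)
    also have "\<dots> = (\<Sum>s\<in>S. if u s = x then y s * F (u s) else 0)"
      by (rule sum.inter_filter[OF assms(1)])
    finally show "(\<Sum>s | s \<in> S \<and> u s = x. y s) * F x
        = (\<Sum>s\<in>S. if u s = x then y s * F (u s) else 0)" .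
  qed
  also have "\<dots> = (\<Sum>s\<in>S. \<Sum>x\<in>X. if u s = x then y s * F (u s) else 0)"
    by (rule sum.swap)
  also have "\<dots> = (\<Sum>s\<in>S. y s * F (u s))"
    using assms by (intro sum.cong refl) auto
  finally show ?thesis .
qed

text \<open>
  Coinciding entries of \<open>u\<close> are merged into one point that carries their total weight, and entries 0 are dropped
  when no exponent is 0, as they contribute nothing. Further points of weight 0 bring
  their number to \<open>card J\<close>.
\<close>

lemma rank_one_sharp_le:
  fixes u y :: "'s \<Rightarrow> real" and n c :: "'j \<Rightarrow> real"
  assumes J: "finite J" "inj_on n J" "\<And>j. j \<in> J \<Longrightarrow> n j < M" "\<And>j. j \<in> J \<Longrightarrow> 0 < c j"
    and \<rho>: "0 < \<rho>"
    and S: "finite S" "card S \<le> card J" "u ` S \<subseteq> {0..sqrt \<rho>}"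
    and zero: "0 \<in> u ` S \<Longrightarrow> \<forall>i\<in>J. 0 \<le> n i"
  shows "(\<Sum>s\<in>S. y s * rpow (u s) M)\<^sup>2
    \<le> sharp_bound J n M \<rho> c * (\<Sum>j\<in>J. c j * (\<Sum>s\<in>S. y s * rpow (u s) (n j))\<^sup>2)"
proof -
  define X0 where "X0 = (if 0 \<in> n ` J then u ` S else u ` S - {0})"
  have X0: "finite X0" "card X0 \<le> card J" "X0 \<subseteq> {0..sqrt \<rho>}"
    using S card_image_le[OF S(1), of u] card_mono[of "u ` S" "u ` S - {0}"]
    by (auto simp: X0_def)
  \<comment> \<open>Only positive points are added, so 0 becomes a point only if it is an entry of \<open>u\<close> and an exponent.\<close>
  have "infinite ({0<..sqrt \<rho>} - X0)"
    using \<rho> X0(1) by (intro Diff_infinite_finite) (auto simp: infinite_Ioc)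
  then obtain B where B: "finite B" "card B = card J - card X0" "B \<subseteq> {0<..sqrt \<rho>} - X0"
    using infinite_arbitrarily_large by blast
  define X where "X = X0 \<union> B"
  have X: "finite X" "card X = card J" "X \<subseteq> {0..sqrt \<rho>}"
    using X0 B card_Un_disjoint[of X0 B] by (force simp: X_def)+
  have zeroX: "0 \<in> n ` J \<and> (\<forall>i\<in>J. 0 \<le> n i)" if "0 \<in> X"
    using that zero B(3) by (auto simp: X_def X0_def split: if_splits)
  define v where "v x = (\<Sum>s | s \<in> S \<and> u s = x. y s)" for x
  have red: "(\<Sum>x\<in>X. v x * rpow x a) = (\<Sum>s\<in>S. y s * rpow (u s) a)"
    if a: "a \<in> insert M (n ` J)" for a
    unfolding v_def
  proof (rule sum_over_image_points[OF S(1) X(1)])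
    fix s assume s: "s \<in> S" "u s \<notin> X"
    then have us: "u s = 0" "0 \<notin> n ` J"
      by (auto simp: X_def X0_def split: if_splits)
    have "J \<noteq> {}"
      using s(1) S by auto
    then have "0 < M"
      using zero us(1) s(1) J(3) by (metis all_not_in_conv imageI order_le_less_trans)
    then show "rpow (u s) a = 0"
      using a us by (auto simp: rpow_zero)
  qed
  have "(\<Sum>x\<in>X. v x * rpow x M)\<^sup>2
      \<le> sharp_bound J n M \<rho> c * (\<Sum>j\<in>J. c j * (\<Sum>x\<in>X. v x * rpow x (n j))\<^sup>2)"
    by (rule power_sums_sq_le[OF J \<rho> X zeroX])
  then show ?thesis
    by (simp add: red)
qed

lemma sum_image_inv_into:
  assumes "inj_on u S"
  shows "(\<Sum>x\<in>u ` S. y (the_inv_into S u x) * F x) = (\<Sum>s\<in>S. y s * (F (u s) :: real))"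
  using assms by (simp add: sum.reindex the_inv_into_f_f)

lemma rank_one_sharp_less:
  fixes u y :: "'s \<Rightarrow> real" and n c :: "'j \<Rightarrow> real"
  assumes J: "finite J" "inj_on n J" "\<And>j. j \<in> J \<Longrightarrow> n j < M" "\<And>j. j \<in> J \<Longrightarrow> 0 < c j"
    and \<rho>: "0 < \<rho>"
    and S: "finite S" "card S = card J" "inj_on u S" "u ` S \<subseteq> {0..sqrt \<rho>}"
      "card J \<ge> 2 \<or> sqrt \<rho> \<notin> u ` S"
    and zero: "0 \<in> u ` S \<Longrightarrow> 0 \<in> n ` J \<and> (\<forall>i\<in>J. 0 \<le> n i)"
    and z: "z \<in> S" "y z \<noteq> 0"
  shows "(\<Sum>s\<in>S. y s * rpow (u s) M)\<^sup>2
    < sharp_bound J n M \<rho> c * (\<Sum>j\<in>J. c j * (\<Sum>s\<in>S. y s * rpow (u s) (n j))\<^sup>2)"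
proof -
  let ?v = "\<lambda>x. y (the_inv_into S u x)"
  have "(\<Sum>x\<in>u ` S. ?v x * rpow x M)\<^sup>2
      < sharp_bound J n M \<rho> c * (\<Sum>j\<in>J. c j * (\<Sum>x\<in>u ` S. ?v x * rpow x (n j))\<^sup>2)"
    by (rule power_sums_sq_less[where z = "u z"])
      (use J \<rho> S zero z in \<open>simp_all add: card_image the_inv_into_f_f\<close>)
  then show ?thesis
    by (simp add: sum_image_inv_into[OF S(3), where y = y])
qed

lemma rank_one_sum_pos:
  fixes u y :: "'s \<Rightarrow> real" and n c :: "'j \<Rightarrow> real"
  assumes J: "finite J" "inj_on n J" "\<And>j. j \<in> J \<Longrightarrow> 0 < c j"
    and S: "finite S" "card S = card J" "inj_on u S" "u ` S \<subseteq> {0..}"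
    and zero: "0 \<in> u ` S \<Longrightarrow> 0 \<in> n ` J"
    and z: "z \<in> S" "y z \<noteq> 0"
  shows "0 < (\<Sum>j\<in>J. c j * (\<Sum>s\<in>S. y s * rpow (u s) (n j))\<^sup>2)"
proof -
  let ?v = "\<lambda>x. y (the_inv_into S u x)"
  have "0 < (\<Sum>j\<in>J. c j * (\<Sum>x\<in>u ` S. ?v x * rpow x (n j))\<^sup>2)"
    by (rule power_sums_pos[where z = "u z"])
      (use J S zero z in \<open>simp_all add: card_image the_inv_into_f_f\<close>)
  then show ?thesis
    by (simp add: sum_image_inv_into[OF S(3), where y = y])
qed

section \<open>Positive semidefinite forms\<close>

text \<open>
  Sums over a finite index set instead of matrices of fixed size, so that a principal submatrix is
  the same function on a smaller set.
\<close>

definition qform :: "'s set \<Rightarrow> ('s \<Rightarrow> 's \<Rightarrow> real) \<Rightarrow> ('s \<Rightarrow> real) \<Rightarrow> real" where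
  "qform S a y = (\<Sum>i\<in>S. \<Sum>j\<in>S. y i * y j * a i j)"

definition psd_on :: "'s set \<Rightarrow> ('s \<Rightarrow> 's \<Rightarrow> real) \<Rightarrow> bool" where
  "psd_on S a \<longleftrightarrow> (\<forall>i\<in>S. \<forall>j\<in>S. a i j = a j i) \<and> (\<forall>y. 0 \<le> qform S a y)"

lemma psd_onI:
  assumes "\<And>i j. i \<in> S \<Longrightarrow> j \<in> S \<Longrightarrow> a i j = a j i" "\<And>y. 0 \<le> qform S a y"
  shows "psd_on S a"
  using assms by (simp add: psd_on_def)

lemma psd_on_sym: "psd_on S a \<Longrightarrow> i \<in> S \<Longrightarrow> j \<in> S \<Longrightarrow> a i j = a j i"
  by (simp add: psd_on_def)

lemma psd_on_qform: "psd_on S a \<Longrightarrow> 0 \<le> qform S a y"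
  by (simp add: psd_on_def)

lemma qform_cong:
  "(\<And>i j. i \<in> S \<Longrightarrow> j \<in> S \<Longrightarrow> a i j = b i j) \<Longrightarrow> (\<And>i. i \<in> S \<Longrightarrow> x i = y i)
    \<Longrightarrow> qform S a x = qform S b y"
  unfolding qform_def by (intro sum.cong refl) simp

lemma psd_on_cong:
  assumes "\<And>i j. i \<in> S \<Longrightarrow> j \<in> S \<Longrightarrow> a i j = b i j" "psd_on S a"
  shows "psd_on S b"
proof (rule psd_onI)
  show "b i j = b j i" if "i \<in> S" "j \<in> S" for i j
    using assms(1)[OF that] assms(1)[OF that(2,1)] psd_on_sym[OF assms(2) that] by simp
  show "0 \<le> qform S b y" for y
    using psd_on_qform[OF assms(2), of y] qform_cong[of S a b y y, OF assms(1) refl] by simp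
qed

lemma qform_add: "qform S (\<lambda>i j. a i j + b i j) y = qform S a y + qform S b y"
  by (simp only: qform_def distrib_left sum.distrib)

lemma qform_diff: "qform S (\<lambda>i j. a i j - b i j) y = qform S a y - qform S b y"
  by (simp only: qform_def right_diff_distrib sum_subtractf)

lemma qform_scale: "qform S (\<lambda>i j. t * a i j) y = t * qform S a y"
  by (simp only: qform_def sum_distrib_left mult.left_commute[of _ t])

lemma qform_sum: "qform S (\<lambda>i j. \<Sum>k\<in>K. a k i j) y = (\<Sum>k\<in>K. qform S (a k) y)"
proof -
  have "qform S (\<lambda>i j. \<Sum>k\<in>K. a k i j) y = (\<Sum>i\<in>S. \<Sum>k\<in>K. \<Sum>j\<in>S. y i * y j * a k i j)"
    unfolding qform_def sum_distrib_left by (intro sum.cong refl sum.swap)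
  also have "\<dots> = (\<Sum>k\<in>K. qform S (a k) y)"
    unfolding qform_def by (rule sum.swap)
  finally show ?thesis .
qed

lemma qform_rank_one: "qform S (\<lambda>i j. u i * u j) y = (\<Sum>i\<in>S. y i * u i)\<^sup>2"
  by (simp only: qform_def power2_eq_square sum_product) (intro sum.cong refl, simp)

lemma qform_support:
  assumes "finite S" "T \<subseteq> S"
    and "\<And>i j. i \<in> S \<Longrightarrow> j \<in> S \<Longrightarrow> i \<notin> T \<or> j \<notin> T \<Longrightarrow> y i * y j * a i j = 0"
  shows "qform S a y = qform T a y"
proof -
  have "(\<Sum>j\<in>S. y i * y j * a i j) = (\<Sum>j\<in>T. y i * y j * a i j)" if "i \<in> S" for i
    using assms that by (intro sum.mono_neutral_right) auto
  moreover have "(\<Sum>i\<in>S. \<Sum>j\<in>T. y i * y j * a i j) = (\<Sum>i\<in>T. \<Sum>j\<in>T. y i * y j * a i j)"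
    using assms by (intro sum.mono_neutral_right) (auto intro!: sum.neutral)
  ultimately show ?thesis
    by (simp add: qform_def)
qed

lemma psd_on_subset:
  assumes "finite S" "psd_on S a" "T \<subseteq> S"
  shows "psd_on T a"
proof (rule psd_onI)
  show "a i j = a j i" if "i \<in> T" "j \<in> T" for i j
    using psd_on_sym[OF assms(2)] assms(3) that by (meson subsetD)
  fix y
  have "qform S a (\<lambda>i. if i \<in> T then y i else 0) = qform T a (\<lambda>i. if i \<in> T then y i else 0)"
    using assms by (intro qform_support) auto
  also have "\<dots> = qform T a y"
    by (intro qform_cong) auto
  finally show "0 \<le> qform T a y"
    using psd_on_qform[OF assms(2)] by metis
qed

lemma psd_on_rank_one: "psd_on S (\<lambda>i j. u i * u j)"
  by (intro psd_onI) (simp_all add: qform_rank_one)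

lemma psd_on_add: "psd_on S a \<Longrightarrow> psd_on S b \<Longrightarrow> psd_on S (\<lambda>i j. a i j + b i j)"
  unfolding psd_on_def qform_add by (metis add_nonneg_nonneg)

lemma psd_on_scale: "0 \<le> t \<Longrightarrow> psd_on S a \<Longrightarrow> psd_on S (\<lambda>i j. t * a i j)"
  unfolding psd_on_def qform_scale by (metis mult_nonneg_nonneg)

lemma qform_line:
  assumes "\<And>i j. i \<in> S \<Longrightarrow> j \<in> S \<Longrightarrow> a i j = a j i"
  shows "qform S a (\<lambda>i. y i + t * x i)
    = qform S a y + 2 * t * (\<Sum>i\<in>S. y i * (\<Sum>j\<in>S. a i j * x j)) + t\<^sup>2 * qform S a x"
proof -
  let ?B = "\<Sum>i\<in>S. y i * (\<Sum>j\<in>S. a i j * x j)"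
  have B: "?B = (\<Sum>i\<in>S. \<Sum>j\<in>S. y i * x j * a i j)"
    unfolding sum_distrib_left by (intro sum.cong refl) simp
  also have "\<dots> = (\<Sum>j\<in>S. \<Sum>i\<in>S. y i * x j * a i j)"
    by (rule sum.swap)
  also have "\<dots> = (\<Sum>i\<in>S. \<Sum>j\<in>S. x i * y j * a i j)"
    using assms by (intro sum.cong refl) simp
  finally have B': "?B = (\<Sum>i\<in>S. \<Sum>j\<in>S. x i * y j * a i j)" .
  have "qform S a (\<lambda>i. y i + t * x i)
      = (\<Sum>i\<in>S. \<Sum>j\<in>S. y i * y j * a i j + t * (y i * x j * a i j) + t * (x i * y j * a i j)
          + t\<^sup>2 * (x i * x j * a i j))"
    unfolding qform_def by (intro sum.cong refl) (simp add: algebra_simps power2_eq_square)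
  also have "\<dots> = qform S a y + t * ?B + t * ?B + t\<^sup>2 * qform S a x"
    by (subst B, subst B') (simp only: qform_def sum.distrib sum_distrib_left)
  finally show ?thesis by simp
qed

lemma sum_unit_vector:
  assumes "finite S" "s \<in> S"
  shows "(\<Sum>i\<in>S. F i * (if i = s then 1 else 0 :: real)) = F s"
    and "(\<Sum>i\<in>S. (if i = s then 1 else 0) * F i) = F s"
  using assms by (simp_all add: if_distrib[of "\<lambda>x. _ * x"] if_distrib[of "\<lambda>x. x * _"] cong: if_cong)

lemma qform_unit_vector:
  assumes "finite S" "s \<in> S"
  shows "qform S a (\<lambda>i. if i = s then 1 else 0) = a s s"
proof -
  have "qform S a (\<lambda>i. if i = s then 1 else 0)
      = qform {s} a (\<lambda>i. if i = s then 1 else 0)"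
    using assms by (intro qform_support) auto
  then show ?thesis
    by (simp add: qform_def)
qed

lemma psd_on_diag_nonneg:
  assumes "finite S" "psd_on S a" "s \<in> S"
  shows "0 \<le> a s s"
  using psd_on_qform[OF assms(2), of "\<lambda>i. if i = s then 1 else 0"]
  by (simp add: qform_unit_vector[OF assms(1,3)])

text \<open>
  Otherwise the form would be unbounded below on a line in direction \<open>x\<close>.
\<close>

lemma psd_on_null_vector:
  assumes "finite S" "psd_on S a" "qform S a x = 0" "i \<in> S"
  shows "(\<Sum>j\<in>S. a i j * x j) = 0"
proof (rule ccontr)
  define w where "w = (\<Sum>j\<in>S. a i j * x j)"
  let ?e = "\<lambda>k. if k = i then 1 else 0 :: real"
  assume "(\<Sum>j\<in>S. a i j * x j) \<noteq> 0"
  then have w: "w \<noteq> 0"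
    by (simp add: w_def)
  \<comment> \<open>Chosen such that the form takes the value \<open>-1\<close>.\<close>
  define t where "t = - (a i i + 1) / (2 * w)"
  have "qform S a (\<lambda>k. ?e k + t * x k)
      = qform S a ?e + 2 * t * (\<Sum>k\<in>S. ?e k * (\<Sum>j\<in>S. a k j * x j)) + t\<^sup>2 * qform S a x"
    by (rule qform_line) (rule psd_on_sym[OF assms(2)])
  also have "\<dots> = a i i + 2 * t * w"
    by (simp only: qform_unit_vector[OF assms(1,4)] sum_unit_vector[OF assms(1,4)] assms(3) w_def
        mult_zero_right add_0_right)
  also have "\<dots> = - 1"
    using w by (simp add: t_def field_simps)
  finally show False
    using psd_on_qform[OF assms(2), of "\<lambda>k. ?e k + t * x k"] by linarith
qed

text \<open>
  This is the Cauchy-Schwarz inequality \<open>(y\<^sup>T a x)\<^sup>2 \<le> (y\<^sup>T a y) (x\<^sup>T a x)\<close>, obtained by minimizing the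
  form on the line \<open>y + t x\<close>. If \<open>x\<^sup>T a x = 0\<close>, division by zero makes \<open>u\<close> zero, which is the right value.
\<close>

lemma psd_on_deflation_along:
  assumes a: "psd_on S a" and u: "\<And>i. i \<in> S \<Longrightarrow> u i = (\<Sum>j\<in>S. a i j * x j) / sqrt (qform S a x)"
  shows "psd_on S (\<lambda>i j. a i j - u i * u j)"
proof (rule psd_onI)
  show "a i j - u i * u j = a j i - u j * u i" if "i \<in> S" "j \<in> S" for i j
    using psd_on_sym[OF a that] by simp
  fix y
  let ?q = "qform S a x"
  define B where "B = (\<Sum>i\<in>S. y i * (\<Sum>j\<in>S. a i j * x j))"
  have q: "0 \<le> ?q"
    by (rule psd_on_qform[OF a])
  have "(\<Sum>i\<in>S. y i * u i) = B / sqrt ?q"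
    unfolding B_def sum_divide_distrib using u by (intro sum.cong) auto
  then have "qform S (\<lambda>i j. a i j - u i * u j) y = qform S a y - B\<^sup>2 / ?q"
    using q by (simp only: qform_diff qform_rank_one) (simp add: power_divide)
  also have "\<dots> = qform S a y + 2 * (- B / ?q) * B + (- B / ?q)\<^sup>2 * ?q"
    by (simp add: power2_eq_square)
  also have "\<dots> = qform S a (\<lambda>i. y i + (- B / ?q) * x i)"
    unfolding B_def by (rule qform_line[symmetric]) (rule psd_on_sym[OF a])
  finally show "0 \<le> qform S (\<lambda>i j. a i j - u i * u j) y"
    using psd_on_qform[OF a] by simp
qed

text \<open>
  The Schur complement. For \<open>a s s = 0\<close> it degenerates correctly: then row \<open>s\<close> and \<open>u\<close> are both zero.
\<close>

lemma psd_on_deflation: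
  assumes S: "finite S" and a: "psd_on S a" and s: "s \<in> S"
    and u: "u = (\<lambda>i. a i s / sqrt (a s s))"
  shows "psd_on S (\<lambda>i j. a i j - u i * u j)"
    and "\<And>j. j \<in> S \<Longrightarrow> u s * u j = a s j"
proof -
  let ?e = "\<lambda>k. if k = s then 1 else 0 :: real"
  show "psd_on S (\<lambda>i j. a i j - u i * u j)"
    by (rule psd_on_deflation_along[OF a, where x = ?e])
      (simp only: u sum_unit_vector[OF S s] qform_unit_vector[OF S s])
  fix j assume j: "j \<in> S"
  have "a s s = 0 \<Longrightarrow> a j s = 0"
    using psd_on_null_vector[OF S a _ j, of ?e]
    by (simp only: sum_unit_vector[OF S s] qform_unit_vector[OF S s])
  then show "u s * u j = a s j"
    using psd_on_diag_nonneg[OF S a s] psd_on_sym[OF a s j] by (simp add: u)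
qed

text \<open>
  The Schur product theorem. Splitting \<open>a = a' + u u\<^sup>T\<close>, the part \<open>a'\<close> lives on a smaller index set, and
  the part \<open>u u\<^sup>T\<close> only rescales the variables of \<open>b\<close>.
\<close>

lemma psd_on_hadamard:
  assumes "finite S" "psd_on S a" "psd_on S b"
  shows "psd_on S (\<lambda>i j. a i j * b i j)"
  using assms
proof (induction S arbitrary: a rule: finite_induct)
  case empty
  show ?case by (simp add: psd_on_def qform_def)
next
  case (insert s F)
  note fin = finite.insertI[OF insert.hyps(1), of s]
  define u where "u i = a i s / sqrt (a s s)" for i
  define a' where "a' i j = a i j - u i * u j" for i j
  note defl = psd_on_deflation[OF fin insert.prems(1) insertI1, of u, unfolded u_def, OF refl,
      folded u_def]
  have a': "psd_on (insert s F) a'"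
    using defl(1) by (simp add: a'_def[abs_def])
  have row: "a' i j = 0" if "i \<in> insert s F" "j \<in> insert s F" "i \<notin> F \<or> j \<notin> F" for i j
    using defl(2) that psd_on_sym[OF a', of i j] by (auto simp: a'_def mult.commute)
  show ?case
  proof (rule psd_onI)
    fix y
    have "psd_on F (\<lambda>i j. a' i j * b i j)"
      using insert.IH[of a'] psd_on_subset[OF fin a'] psd_on_subset[OF fin insert.prems(2)] by blast
    moreover have "qform (insert s F) (\<lambda>i j. a' i j * b i j) y = qform F (\<lambda>i j. a' i j * b i j) y"
      using row fin by (intro qform_support) auto
    moreover have "qform (insert s F) (\<lambda>i j. a i j * b i j) y
        = qform (insert s F) (\<lambda>i j. a' i j * b i j + u i * u j * b i j) y"
      by (intro qform_cong) (auto simp: a'_def algebra_simps)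
    moreover have "qform (insert s F) (\<lambda>i j. u i * u j * b i j) y
        = qform (insert s F) b (\<lambda>i. y i * u i)"
      by (simp add: qform_def mult_ac)
    moreover have "0 \<le> qform (insert s F) b (\<lambda>i. y i * u i)"
      by (rule psd_on_qform[OF insert.prems(2)])
    ultimately show "0 \<le> qform (insert s F) (\<lambda>i j. a i j * b i j) y"
      using psd_on_qform[of F "\<lambda>i j. a' i j * b i j" y] by (simp add: qform_add)
  qed (use psd_on_sym[OF insert.prems(1)] psd_on_sym[OF insert.prems(2)] in simp)
qed

definition pd_on :: "'s set \<Rightarrow> ('s \<Rightarrow> 's \<Rightarrow> real) \<Rightarrow> bool" where
  "pd_on S a \<longleftrightarrow> (\<forall>y. (\<exists>i\<in>S. y i \<noteq> 0) \<longrightarrow> 0 < qform S a y)"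

text \<open>
  The vector \<open>e\<^sub>p - e\<^sub>q\<close> detects equal rows. It is written as a point of a line so that the
  expansion of a form along a line applies to it.
\<close>

lemma qform_unit_difference:
  assumes "finite S" "p \<in> S" "q \<in> S" "\<And>i j. i \<in> S \<Longrightarrow> j \<in> S \<Longrightarrow> b i j = b j i"
  shows "qform S b (\<lambda>k. (if k = p then 1 else 0) + (- 1) * (if k = q then 1 else 0))
    = b p p - 2 * b p q + b q q"
proof -
  let ?e = "\<lambda>r k. if k = r then 1 else 0 :: real"
  have "qform S b (\<lambda>k. ?e p k + (- 1) * ?e q k) = qform S b (?e p)
      + 2 * (- 1) * (\<Sum>i\<in>S. ?e p i * (\<Sum>j\<in>S. b i j * ?e q j)) + (- 1)\<^sup>2 * qform S b (?e q)"
    by (rule qform_line) (rule assms(4))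
  then show ?thesis
    by (simp only: qform_unit_vector[OF assms(1,2)] qform_unit_vector[OF assms(1,3)]
        sum_unit_vector[OF assms(1,2)] sum_unit_vector[OF assms(1,3)]) simp
qed

lemma pd_on_rows_distinct:
  assumes S: "finite S" and pd: "pd_on S (\<lambda>i j. \<phi> (a i j))"
    and sym: "\<And>i j. i \<in> S \<Longrightarrow> j \<in> S \<Longrightarrow> a i j = a j i" and pq: "p \<in> S" "q \<in> S" "p \<noteq> q"
  shows "\<exists>k\<in>S. a p k \<noteq> a q k"
proof (rule ccontr)
  assume "\<not> (\<exists>k\<in>S. a p k \<noteq> a q k)"
  then have eq: "a p p = a p q" "a p q = a q q"
    using pq sym[OF pq(1,2)] by auto
  let ?y = "\<lambda>k. (if k = p then 1 else 0) + (- 1) * (if k = q then 1 else 0) :: real"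
  have "\<exists>i\<in>S. ?y i \<noteq> 0"
    using pq by (intro bexI[of _ p]) auto
  then have "0 < qform S (\<lambda>i j. \<phi> (a i j)) ?y"
    by (rule pd[unfolded pd_on_def, THEN spec, THEN mp])
  also have "\<dots> = \<phi> (a p p) - 2 * \<phi> (a p q) + \<phi> (a q q)"
    using sym by (intro qform_unit_difference S pq) simp
  finally show False
    by (simp add: eq)
qed

lemma rank_one_minorant_rows_distinct:
  assumes S: "finite S" and psd: "psd_on S (\<lambda>i j. a i j - u i * u j)"
    and u: "inj_on u S" and sym: "\<And>i j. i \<in> S \<Longrightarrow> j \<in> S \<Longrightarrow> a i j = a j i"
    and pq: "p \<in> S" "q \<in> S" "p \<noteq> q"
  shows "\<exists>k\<in>S. a p k \<noteq> a q k"
proof (rule ccontr)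
  assume "\<not> (\<exists>k\<in>S. a p k \<noteq> a q k)"
  then have eq: "a p p = a p q" "a p q = a q q"
    using pq sym[OF pq(1,2)] by auto
  let ?b = "\<lambda>i j. a i j - u i * u j"
  have "0 \<le> qform S ?b (\<lambda>k. (if k = p then 1 else 0) + (- 1) * (if k = q then 1 else 0))"
    by (rule psd_on_qform[OF psd])
  also have "\<dots> = ?b p p - 2 * ?b p q + ?b q q"
    using sym by (intro qform_unit_difference S pq) simp
  also have "\<dots> = - ((u p - u q)\<^sup>2)"
    by (simp add: eq power2_eq_square algebra_simps)
  finally have "u p = u q"
    by simp
  then show False
    using inj_onD[OF u] pq by blast
qed

section \<open>Entrywise powers of positive semidefinite matrices\<close>

lemma rpow_has_derivative:
  assumes "0 < z"
  shows "((\<lambda>z. rpow z \<alpha>) has_real_derivative \<alpha> * rpow z (\<alpha> - 1)) (at z)"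
proof (cases "\<alpha> = 0")
  case True
  then show ?thesis by (simp add: rpow_def[abs_def])
next
  case False
  have "\<alpha> * z powr (\<alpha> - 1) = \<alpha> * rpow z (\<alpha> - 1)"
    using assms by (simp add: rpow_pos)
  then show ?thesis
    using has_real_derivative_powr[OF assms, of \<alpha>] False by (simp add: rpow_def[abs_def])
qed

lemma rpow_continuous_on:
  assumes "0 \<le> \<alpha>"
  shows "continuous_on {0..} (\<lambda>z. rpow z \<alpha>)"
proof (cases "\<alpha> = 0")
  case False
  then have "continuous_on {0..} (\<lambda>z. z powr \<alpha>)"
    using assms by (intro continuous_on_powr' continuous_intros) auto
  then show ?thesis
    using False by (simp add: rpow_def)
qed (simp add: rpow_def)

text \<open>
  The derivative of \<open>F[b + t (a - b)]\<close> in \<open>t\<close> is the Hadamard product of \<open>F'[b + t (a - b)]\<close> and \<open>a - b\<close>. Outside \<open>T\<close> the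
  second factor vanishes, so positivity of the first one is only required on \<open>T\<close>. Entries may be 0 at the ends of
  the segment, or on all of it if \<open>a i j = b i j = 0\<close>; therefore \<open>F\<close> is assumed differentiable on the open half-line and
  merely continuous at 0.
\<close>

lemma qform_entrywise_mono:
  fixes a b :: "'s \<Rightarrow> 's \<Rightarrow> real" and F F' :: "real \<Rightarrow> real"
  assumes S: "finite S" "T \<subseteq> S"
    and pos: "\<And>i j. i \<in> S \<Longrightarrow> j \<in> S \<Longrightarrow> 0 \<le> a i j \<and> 0 \<le> b i j"
    and supp: "\<And>i j. i \<in> S \<Longrightarrow> j \<in> S \<Longrightarrow> i \<notin> T \<or> j \<notin> T \<Longrightarrow> a i j = b i j"
    and diff: "psd_on T (\<lambda>i j. a i j - b i j)"
    and F: "continuous_on {0..} F" "\<And>z. 0 < z \<Longrightarrow> (F has_real_derivative F' z) (at z)"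
    and F': "\<And>t. 0 < t \<Longrightarrow> t < 1 \<Longrightarrow> psd_on T (\<lambda>i j. F' (b i j + t * (a i j - b i j)))"
  shows "qform S (\<lambda>i j. F (b i j)) y \<le> qform S (\<lambda>i j. F (a i j)) y"
proof -
  define z where "z t i j = b i j + t * (a i j - b i j)" for t i j
  define \<phi> where "\<phi> t = qform S (\<lambda>i j. F (z t i j)) y" for t
  have z_convex: "z t i j = (1 - t) * b i j + t * a i j" for t i j
    by (simp add: z_def algebra_simps)
  have z_nonneg: "0 \<le> z t i j" if "0 \<le> t" "t \<le> 1" "i \<in> S" "j \<in> S" for t i j
    using pos[OF that(3,4)] that by (simp add: z_convex)
  have der: "((\<lambda>t. F (z t i j)) has_real_derivative F' (z t i j) * (a i j - b i j)) (at t)"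
    if t: "0 < t" "t < 1" and ij: "i \<in> S" "j \<in> S" for t i j
  proof (cases "a i j = b i j")
    case True
    then show ?thesis by (simp add: z_def)
  next
    case False
    have "0 < z t i j"
    proof (cases "0 < a i j")
      case True
      then show ?thesis
        using pos[OF ij] t unfolding z_convex by (intro add_nonneg_pos) auto
    next
      case a: False
      then have "0 < b i j"
        using pos[OF ij] False by simp
      then show ?thesis
        using pos[OF ij] t unfolding z_convex by (intro add_pos_nonneg) auto
    qed
    moreover have "((\<lambda>t. z t i j) has_real_derivative (a i j - b i j)) (at t)"
      unfolding z_def by (auto intro!: derivative_eq_intros)
    ultimately show ?thesis
      by (intro DERIV_chain2[where f = F and g = "\<lambda>t. z t i j"] F(2))
  qed
  have "\<phi> 0 \<le> \<phi> 1"
  proof (rule DERIV_nonneg_imp_increasing_open[where f = \<phi>])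
    fix t :: real
    assume t: "0 < t" "t < 1"
    let ?d = "qform S (\<lambda>i j. F' (z t i j) * (a i j - b i j)) y"
    have "(\<phi> has_real_derivative ?d) (at t)"
      unfolding \<phi>_def qform_def using t by (intro DERIV_sum DERIV_cmult der) auto
    moreover have "0 \<le> ?d"
    proof -
      have "psd_on T (\<lambda>i j. F' (z t i j) * (a i j - b i j))"
        using psd_on_hadamard[OF finite_subset[OF S(2,1)] F'[OF t] diff] by (simp add: z_def)
      then have "0 \<le> qform T (\<lambda>i j. F' (z t i j) * (a i j - b i j)) y"
        by (rule psd_on_qform)
      also have "\<dots> = ?d"
        using supp S by (intro qform_support[symmetric]) auto
      finally show ?thesis .
    qed
    ultimately show "\<exists>d. (\<phi> has_real_derivative d) (at t) \<and> 0 \<le> d"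
      by blast
  next
    have "continuous_on {0..1} (\<lambda>t. F (z t i j))" if "i \<in> S" "j \<in> S" for i j
    proof (rule continuous_on_compose2[OF F(1), where f = "\<lambda>t. z t i j"])
      show "continuous_on {0..1} (\<lambda>t. z t i j)"
        unfolding z_def by (intro continuous_intros)
    qed (use z_nonneg that in auto)
    then show "continuous_on {0..1} \<phi>"
      unfolding \<phi>_def qform_def by (intro continuous_on_sum continuous_on_mult_left) auto
  qed simp
  then show ?thesis
    by (simp add: \<phi>_def z_def)
qed

lemma psd_on_segment:
  assumes "psd_on T a" "psd_on T b" "0 \<le> t" "t \<le> 1"
  shows "psd_on T (\<lambda>i j. b i j + t * (a i j - b i j))"
proof -
  have "psd_on T (\<lambda>i j. (1 - t) * b i j + t * a i j)"
    using assms by (intro psd_on_add psd_on_scale) auto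
  then show ?thesis
    by (simp add: algebra_simps)
qed

lemma nat_or_large_minus_1:
  assumes "(\<alpha>::real) \<in> \<nat> \<or> r \<le> \<alpha>" "\<alpha> \<noteq> 0"
  shows "\<alpha> - 1 \<in> \<nat> \<or> r - 1 \<le> \<alpha> - 1"
proof (cases "\<alpha> \<in> \<nat>")
  case True
  then obtain m where "\<alpha> = real m" by (auto elim: Nats_cases)
  then have "\<alpha> - 1 = real (m - 1)"
    using assms(2) by (cases m) auto
  then show ?thesis by simp
qed (use assms in simp)

text \<open>
  FitzGerald and Horn. Comparing \<open>a\<close> with the rank-one matrix \<open>u u\<^sup>T\<close> built from its column \<open>s\<close> lowers both the dimension and the
  exponent by one.
\<close>

lemma psd_on_rpow:
  assumes "finite S" "psd_on S a" "\<And>i j. i \<in> S \<Longrightarrow> j \<in> S \<Longrightarrow> 0 \<le> a i j"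
    and "\<alpha> \<in> \<nat> \<or> real (card S) \<le> \<alpha> + 2"
  shows "psd_on S (\<lambda>i j. rpow (a i j) \<alpha>)"
  using assms
proof (induction S arbitrary: a \<alpha> rule: finite_induct)
  case empty
  show ?case by (simp add: psd_on_def qform_def)
next
  case (insert s T)
  note fin = finite.insertI[OF insert.hyps(1), of s]
  note sym = psd_on_sym[OF insert.prems(1)]
  have symm: "rpow (a i j) \<alpha> = rpow (a j i) \<alpha>" if "i \<in> insert s T" "j \<in> insert s T" for i j
    using sym[OF that] by simp
  consider "\<alpha> = 0" | "T = {}" | "\<alpha> \<noteq> 0" "T \<noteq> {}" by blast
  then show ?case
  proof cases
    case 1
    then show ?thesis
      using psd_on_rank_one[of "insert s T" "\<lambda>_. 1"] by (simp add: rpow_def)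
  next
    case 2
    then show ?thesis
      by (auto simp: psd_on_def qform_def rpow_nonneg)
  next
    case 3
    have cT: "1 \<le> card T"
      using 3 insert.hyps(1) by (simp add: Suc_le_eq card_gt_0_iff)
    then have pos: "0 \<le> \<alpha>"
      using insert.prems(3) insert.hyps by (auto simp: Nats_def)
    have \<alpha>1: "\<alpha> - 1 \<in> \<nat> \<or> real (card T) \<le> (\<alpha> - 1) + 2"
      using nat_or_large_minus_1[of \<alpha> "real (card T) - 1"] insert.prems(3) insert.hyps 3 by auto
    \<comment> \<open>The rank-one matrix agrees with \<open>a\<close> in row and column \<open>s\<close>.\<close>
    define u where "u i = a i s / sqrt (a s s)" for i
    note defl = psd_on_deflation[OF fin insert.prems(1) insertI1, of u, unfolded u_def, OF refl,
        folded u_def]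
    have ass: "0 \<le> a s s"
      using insert.prems(2) by simp
    have u0: "0 \<le> u i" if "i \<in> insert s T" for i
      using insert.prems(2)[OF that insertI1] ass by (simp add: u_def)
    have sub: "T \<subseteq> insert s T" by auto
    show ?thesis
    proof (rule psd_onI[OF symm])
      fix y
      have "0 \<le> (\<Sum>i\<in>insert s T. y i * rpow (u i) \<alpha>)\<^sup>2"
        by simp
      also have "\<dots> = qform (insert s T) (\<lambda>i j. rpow (u i * u j) \<alpha>) y"
        by (simp only: rpow_mult qform_rank_one)
      also have "\<dots> \<le> qform (insert s T) (\<lambda>i j. rpow (a i j) \<alpha>) y"
      proof (rule qform_entrywise_mono[OF fin sub, where F = "\<lambda>z. rpow z \<alpha>"
            and F' = "\<lambda>z. \<alpha> * rpow z (\<alpha> - 1)" and a = a and b = "\<lambda>i j. u i * u j"])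
        show "a i j = u i * u j" if "i \<in> insert s T" "j \<in> insert s T" "i \<notin> T \<or> j \<notin> T" for i j
        proof -
          have "i = s \<or> j = s"
            using that by blast
          then show ?thesis
            using defl(2)[OF that(1)] defl(2)[OF that(2)] sym[OF that(1,2)]
            by (auto simp: mult.commute)
        qed
        show "psd_on T (\<lambda>i j. a i j - u i * u j)"
          by (rule psd_on_subset[OF fin defl(1) sub])
        show "psd_on T (\<lambda>i j. \<alpha> * rpow (u i * u j + t * (a i j - u i * u j)) (\<alpha> - 1))"
          if "0 < t" "t < 1" for t
        proof (rule psd_on_scale[OF pos], rule insert.IH)
          show "psd_on T (\<lambda>i j. u i * u j + t * (a i j - u i * u j))"
            using that by (intro psd_on_segment psd_on_rank_one psd_on_subset[OF fin insert.prems(1)]) auto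
          show "0 \<le> u i * u j + t * (a i j - u i * u j)" if "i \<in> T" "j \<in> T" for i j
          proof -
            have "0 \<le> (1 - t) * (u i * u j) + t * a i j"
              using that u0 insert.prems(2) \<open>0 < t\<close> \<open>t < 1\<close>
              by (intro add_nonneg_nonneg mult_nonneg_nonneg) auto
            then show ?thesis by (simp add: algebra_simps)
          qed
        qed (rule \<alpha>1)
      qed (use insert.prems(2) u0 pos in \<open>auto intro: rpow_has_derivative rpow_continuous_on\<close>)
      finally show "0 \<le> qform (insert s T) (\<lambda>i j. rpow (a i j) \<alpha>) y" .
    qed
  qed
qed

text \<open>
  Here the difference \<open>a - b\<close> has full support, so the derivative is examined in the same dimension and the exponent
  has to be larger by one than for preserving positivity.
\<close>

lemma qform_rpow_mono:
  assumes S: "finite S" and a: "\<And>i j. i \<in> S \<Longrightarrow> j \<in> S \<Longrightarrow> 0 \<le> a i j \<and> 0 \<le> b i j"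
    and psd: "psd_on S b" "psd_on S (\<lambda>i j. a i j - b i j)"
    and \<alpha>: "0 \<le> \<alpha>" "\<alpha> \<in> \<nat> \<or> real (card S) - 1 \<le> \<alpha>"
  shows "qform S (\<lambda>i j. rpow (b i j) \<alpha>) y \<le> qform S (\<lambda>i j. rpow (a i j) \<alpha>) y"
proof (cases "\<alpha> = 0")
  case True
  then show ?thesis by (simp add: rpow_def)
next
  case False
  have psda: "psd_on S a"
    using psd_on_add[OF psd] by simp
  show ?thesis
  proof (rule qform_entrywise_mono[OF S order_refl a, where F = "\<lambda>z. rpow z \<alpha>"
        and F' = "\<lambda>z. \<alpha> * rpow z (\<alpha> - 1)"])
    show "psd_on S (\<lambda>i j. \<alpha> * rpow (b i j + t * (a i j - b i j)) (\<alpha> - 1))" if t: "0 < t" "t < 1" for t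
    proof (rule psd_on_scale[OF \<alpha>(1)], rule psd_on_rpow[OF S])
      show "psd_on S (\<lambda>i j. b i j + t * (a i j - b i j))"
        using t by (intro psd_on_segment psda psd) auto
      show "0 \<le> b i j + t * (a i j - b i j)" if "i \<in> S" "j \<in> S" for i j
      proof -
        have "0 \<le> (1 - t) * b i j + t * a i j"
          using a[OF that] t by (intro add_nonneg_nonneg mult_nonneg_nonneg) auto
        then show ?thesis by (simp add: algebra_simps)
      qed
      show "\<alpha> - 1 \<in> \<nat> \<or> real (card S) \<le> \<alpha> - 1 + 2"
        using nat_or_large_minus_1[OF \<alpha>(2) False] by auto
    qed
  qed (use psd \<alpha> in \<open>auto intro: rpow_has_derivative rpow_continuous_on\<close>)
qed

section \<open>The sharp inequality for positive semidefinite matrices\<close>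

text \<open>
  Termwise, the constant on the right has the additional factor \<open>((M - n\<^sub>k) / (n\<^sub>j - n\<^sub>k))\<^sup>2\<close>, and this is at
  least \<open>M / n\<^sub>j\<close> because \<open>0 \<le> n\<^sub>k\<close>. It makes the induction on the dimension work.
\<close>

lemma sharp_bound_derivative_le:
  fixes n c :: "'j \<Rightarrow> real"
  assumes J: "finite J" "k \<in> J" "inj_on n J" "\<And>j. j \<in> J \<Longrightarrow> n k \<le> n j" "0 \<le> n k"
    and M: "\<And>j. j \<in> J \<Longrightarrow> n j < M" and c: "\<And>j. j \<in> J \<Longrightarrow> 0 < c j"
  shows "M * sharp_bound (J - {k}) (\<lambda>j. n j - 1) (M - 1) \<rho> (\<lambda>j. c j * n j)
    \<le> sharp_bound J n M \<rho> c"
proof -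
  define P where "P A j = (\<Prod>i\<in>A - {j}. ((M - n i) / (n j - n i))\<^sup>2)" for A j
  have P0: "0 \<le> P A j" for A j
    unfolding P_def by (intro prod_nonneg) auto
  have gt: "n k < n j" if "j \<in> J - {k}" for j
    using J(3,2) J(4)[of j] that by (force simp: inj_on_def order_le_less)
  have step: "M * (P (J - {k}) j * \<rho> powr (M - n j) / (c j * n j))
      \<le> P J j * \<rho> powr (M - n j) / c j" if j: "j \<in> J - {k}" for j
  proof -
    let ?x = "(M - n k) / (n j - n k)"
    have nj: "0 < n j" "n k < n j" "n j < M" "0 < c j"
      using gt[OF j] J(5) M c j by auto
    have "M * (n j - n k) \<le> (M - n k) * n j"
      using mult_left_mono[of "n j" M "n k"] nj J(5) by (simp add: algebra_simps)
    then have "M / n j \<le> ?x"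
      using nj by (simp add: field_simps)
    also have "?x \<le> ?x\<^sup>2"
      using nj by (intro self_le_power) auto
    finally have x: "M / n j \<le> ?x\<^sup>2" .
    have PJ: "P J j = ?x\<^sup>2 * P (J - {k}) j"
    proof -
      have "J - {k} - {j} = J - {j} - {k}" "finite (J - {j})" "k \<in> J - {j}"
        using J(1,2) j by auto
      then show ?thesis
        using prod.remove[of "J - {j}" k "\<lambda>i. ((M - n i) / (n j - n i))\<^sup>2"] by (simp add: P_def)
    qed
    have "M / n j * (P (J - {k}) j * \<rho> powr (M - n j) / c j)
        \<le> ?x\<^sup>2 * (P (J - {k}) j * \<rho> powr (M - n j) / c j)"
      using P0 nj by (intro mult_right_mono x) auto
    then show ?thesis
      using PJ by (simp add: mult_ac)
  qed
  have "M * sharp_bound (J - {k}) (\<lambda>j. n j - 1) (M - 1) \<rho> (\<lambda>j. c j * n j)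
      = (\<Sum>j\<in>J - {k}. M * (P (J - {k}) j * \<rho> powr (M - n j) / (c j * n j)))"
    by (simp add: sharp_bound_def P_def sum_distrib_left)
  also have "\<dots> \<le> (\<Sum>j\<in>J - {k}. P J j * \<rho> powr (M - n j) / c j)"
    by (intro sum_mono step)
  also have "\<dots> \<le> (\<Sum>j\<in>J. P J j * \<rho> powr (M - n j) / c j)"
    using J(1) c P0 by (intro sum_mono2) (auto simp: less_imp_le)
  finally show ?thesis
    by (simp add: sharp_bound_def P_def)
qed

text \<open>
  For \<open>t = 1 / sharp_bound J n M \<rho> c\<close> this is \<open>g\<close>. The parameter is kept because differentiation and
  dropping the lowest exponent lead to a \<open>t\<close> that is in general smaller than the new critical value.
\<close>

definition critical_fun ::
  "'j set \<Rightarrow> ('j \<Rightarrow> real) \<Rightarrow> real \<Rightarrow> ('j \<Rightarrow> real) \<Rightarrow> real \<Rightarrow> real \<Rightarrow> real" where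
  "critical_fun J n M c t z = (\<Sum>j\<in>J. c j * rpow z (n j)) - t * rpow z M"

lemma qform_critical_fun:
  "qform S (\<lambda>i j. critical_fun J n M c t (a i j)) y
    = (\<Sum>k\<in>J. c k * qform S (\<lambda>i j. rpow (a i j) (n k)) y) - t * qform S (\<lambda>i j. rpow (a i j) M) y"
  by (simp only: critical_fun_def qform_diff qform_sum qform_scale)

lemma qform_rpow_rank_one:
  "qform S (\<lambda>i j. rpow (u i * u j) \<alpha>) y = (\<Sum>i\<in>S. y i * rpow (u i) \<alpha>)\<^sup>2"
  by (simp only: rpow_mult qform_rank_one)

lemma rank_one_critical_fun_nonneg:
  fixes u y :: "'s \<Rightarrow> real" and n c :: "'j \<Rightarrow> real"
  assumes J: "finite J" "inj_on n J" "\<And>j. j \<in> J \<Longrightarrow> n j < M" "\<And>j. j \<in> J \<Longrightarrow> 0 < c j"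
    and \<rho>: "0 < \<rho>"
    and S: "finite S" "card S \<le> card J" "u ` S \<subseteq> {0..sqrt \<rho>}"
    and zero: "0 \<in> u ` S \<Longrightarrow> \<forall>i\<in>J. 0 \<le> n i"
    and t: "0 \<le> t" "t * sharp_bound J n M \<rho> c \<le> 1"
  shows "0 \<le> qform S (\<lambda>i j. critical_fun J n M c t (u i * u j)) y"
proof -
  define H where "H = (\<Sum>j\<in>J. c j * (\<Sum>s\<in>S. y s * rpow (u s) (n j))\<^sup>2)"
  have H: "0 \<le> H"
    unfolding H_def using J(4) by (intro sum_nonneg mult_nonneg_nonneg) (auto simp: less_imp_le)
  have "(\<Sum>s\<in>S. y s * rpow (u s) M)\<^sup>2 \<le> sharp_bound J n M \<rho> c * H"
    unfolding H_def by (rule rank_one_sharp_le[OF J \<rho> S zero])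
  then have "t * (\<Sum>s\<in>S. y s * rpow (u s) M)\<^sup>2 \<le> t * (sharp_bound J n M \<rho> c * H)"
    using t(1) by (rule mult_left_mono)
  also have "\<dots> \<le> 1 * H"
    unfolding mult.assoc[symmetric] using t(2) H by (rule mult_right_mono)
  finally show ?thesis
    by (simp add: qform_critical_fun qform_rpow_rank_one H_def)
qed

lemma deflation_vector_bounds:
  assumes S: "finite S" and a: "psd_on S a" and s: "s \<in> S"
    and range: "\<And>i j. i \<in> S \<Longrightarrow> j \<in> S \<Longrightarrow> 0 \<le> a i j \<and> a i j \<le> \<rho>"
    and u: "u = (\<lambda>i. a i s / sqrt (a s s))" and i: "i \<in> S"
  shows "0 \<le> u i" "u i \<le> sqrt \<rho>"
proof -
  show u0: "0 \<le> u i"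
    using range s i by (simp add: u)
  have "0 \<le> a i i - u i * u i"
    using psd_on_diag_nonneg[OF S psd_on_deflation(1)[OF S a s u] i] .
  then have "(u i)\<^sup>2 \<le> \<rho>"
    using range[OF i i] by (simp add: power2_eq_square)
  then show "u i \<le> sqrt \<rho>"
    by (rule real_le_rsqrt)
qed

lemma critical_fun_has_derivative:
  assumes "0 < z"
  shows "(critical_fun J n M c t has_real_derivative
    (\<Sum>j\<in>J. c j * (n j * rpow z (n j - 1))) - t * (M * rpow z (M - 1))) (at z)"
  unfolding critical_fun_def[abs_def]
  by (intro DERIV_diff DERIV_sum DERIV_cmult rpow_has_derivative assms)

lemma nat_or_large_ge_1:
  assumes "(\<alpha>::real) \<in> \<nat> \<or> r \<le> \<alpha>" "0 < \<alpha>" "1 \<le> r"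
  shows "1 \<le> \<alpha>"
proof (cases "\<alpha> \<in> \<nat>")
  case True
  then obtain m where "\<alpha> = real m" by (auto elim: Nats_cases)
  then show ?thesis
    using assms(2) by (cases m) auto
qed (use assms in simp)

text \<open>
  The derivative of the critical function is \<open>c\<^sub>k n\<^sub>k z^{n\<^sub>k - 1}\<close> for the lowest exponent \<open>n\<^sub>k\<close>, which
  preserves positivity by FitzGerald and Horn, plus a critical function for the other exponents
  lowered by one. By induction the latter dominates its value at a rank-one matrix, which is
  non-negative.
\<close>

lemma critical_fun_deflation_mono:
  fixes a :: "'s \<Rightarrow> 's \<Rightarrow> real" and n c :: "'j \<Rightarrow> real"
  assumes "finite J" "inj_on n J" "\<And>j. j \<in> J \<Longrightarrow> n j < M" "\<And>j. j \<in> J \<Longrightarrow> 0 < c j"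
    and "0 < \<rho>" and "finite S" "card S \<le> card J" and "psd_on S a"
    and "\<And>i j. i \<in> S \<Longrightarrow> j \<in> S \<Longrightarrow> 0 \<le> a i j \<and> a i j \<le> \<rho>"
    and "\<And>\<alpha>. \<alpha> \<in> insert M (n ` J) \<Longrightarrow> 0 \<le> \<alpha> \<and> (\<alpha> \<in> \<nat> \<or> real (card S) - 1 \<le> \<alpha>)"
    and "0 \<le> t" "t * sharp_bound J n M \<rho> c \<le> 1"
    and "s \<in> S" "u = (\<lambda>i. a i s / sqrt (a s s))"
  shows "qform S (\<lambda>i j. critical_fun J n M c t (u i * u j)) y
    \<le> qform S (\<lambda>i j. critical_fun J n M c t (a i j)) y"
  using assms
proof (induction "card S" arbitrary: S J n M c t a s u y)
  case 0
  have False
    using "0.hyps" "0.prems"(6,13) by simp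
  then show ?case ..
next
  case (Suc m)
  note J = Suc.prems(1-4) and \<rho> = Suc.prems(5) and S = Suc.prems(6,7) and a = Suc.prems(8)
    and range = Suc.prems(9) and expo = Suc.prems(10) and t = Suc.prems(11,12)
    and s = Suc.prems(13) and u = Suc.prems(14)
  define T where "T = S - {s}"
  have T: "finite T" "T \<subseteq> S" "card S = Suc (card T)" "m = card T"
    using S(1) card.remove[OF S(1) s] Suc.hyps(2) by (auto simp: T_def)
  note defl = psd_on_deflation[OF S(1) a s u]
  note ub = deflation_vector_bounds[OF S(1) a s range u]
  have uu: "0 \<le> u i * u j \<and> u i * u j \<le> \<rho>" if "i \<in> S" "j \<in> S" for i j
  proof -
    have "u i * u j \<le> sqrt \<rho> * sqrt \<rho>"
      using ub that \<rho> by (intro mult_mono) auto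
    then show ?thesis
      using ub that \<rho> by simp
  qed
  have Jne: "J \<noteq> {}"
    using S(2) T(3) by auto
  define k where "k = arg_min_on n J"
  have k: "k \<in> J" "\<And>j. j \<in> J \<Longrightarrow> n k \<le> n j"
    using arg_min_if_finite[OF J(1) Jne, of n] by (auto simp: k_def not_less)
  have nk: "0 \<le> n k"
    using expo k(1) by blast
  define J' where "J' = J - {k}"
  have npos: "0 < n j" if "j \<in> J'" for j
  proof -
    have "j \<in> J" "n j \<noteq> n k"
      using that k(1) inj_onD[OF J(2), of j k] by (auto simp: J'_def)
    then show ?thesis
      using nk k(2)[of j] by simp
  qed
  have Mpos: "0 < M"
    using nk J(3)[OF k(1)] by simp
  define F' where "F' z = (\<Sum>j\<in>J. c j * (n j * rpow z (n j - 1))) - t * (M * rpow z (M - 1))" for z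
  let ?G = "critical_fun J' (\<lambda>j. n j - 1) (M - 1) (\<lambda>j. c j * n j) (t * M)"
  have F'_split: "F' z = c k * n k * rpow z (n k - 1) + ?G z" for z
    using J(1) k(1) by (simp add: F'_def J'_def critical_fun_def sum.remove[of J k] mult.assoc)
  have step: "psd_on T (\<lambda>i j. F' (z i j))"
    if z: "psd_on T z" "\<And>i j. i \<in> T \<Longrightarrow> j \<in> T \<Longrightarrow> 0 \<le> z i j \<and> z i j \<le> \<rho>" for z
  proof (cases "T = {}")
    case True
    then show ?thesis
      by (simp add: psd_on_def qform_def)
  next
    case False
    then obtain s' where s': "s' \<in> T" by blast
    have cT: "1 \<le> real (card S) - 1"
      using False T(1,3) by (simp add: Suc_le_eq card_gt_0_iff)
    have "psd_on T (\<lambda>i j. c k * n k * rpow (z i j) (n k - 1))"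
    proof (cases "n k = 0")
      case True
      then show ?thesis
        by (simp add: psd_on_def qform_def)
    next
      case False
      have "n k - 1 \<in> \<nat> \<or> real (card T) \<le> n k - 1 + 2"
        using nat_or_large_minus_1[of "n k" "real (card S) - 1"] expo k(1) False T(3) by auto
      then show ?thesis
        using z nk J(4)[OF k(1)] by (intro psd_on_scale psd_on_rpow T(1)) auto
    qed
    moreover have "psd_on T (\<lambda>i j. ?G (z i j))"
    proof (rule psd_onI)
      show "?G (z i j) = ?G (z j i)" if "i \<in> T" "j \<in> T" for i j
        using psd_on_sym[OF z(1) that] by simp
      fix y
      define v where "v = (\<lambda>i. z i s' / sqrt (z s' s'))"
      have J': "finite J'" "inj_on (\<lambda>j. n j - 1) J'" "\<And>j. j \<in> J' \<Longrightarrow> n j - 1 < M - 1"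
        "\<And>j. j \<in> J' \<Longrightarrow> 0 < c j * n j" "card T \<le> card J'"
        using J npos S(2) T(3) k(1) by (auto simp: J'_def inj_on_def)
      have large: "0 \<le> \<alpha> - 1 \<and> (\<alpha> - 1 \<in> \<nat> \<or> real (card T) - 1 \<le> \<alpha> - 1)"
        if "\<alpha> = M \<or> (\<exists>j\<in>J'. \<alpha> = n j)" for \<alpha>
      proof -
        have \<alpha>: "0 < \<alpha>" "\<alpha> \<in> \<nat> \<or> real (card S) - 1 \<le> \<alpha>"
          using that npos Mpos expo[of \<alpha>] by (auto simp: J'_def)
        show ?thesis
          using nat_or_large_ge_1[OF \<alpha>(2,1) cT] nat_or_large_minus_1[OF \<alpha>(2)] \<alpha>(1) T(3) by auto
      qed
      have t': "0 \<le> t * M" "t * M * sharp_bound J' (\<lambda>j. n j - 1) (M - 1) \<rho> (\<lambda>j. c j * n j) \<le> 1"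
      proof -
        show "0 \<le> t * M"
          using t(1) Mpos by simp
        have "t * (M * sharp_bound J' (\<lambda>j. n j - 1) (M - 1) \<rho> (\<lambda>j. c j * n j))
            \<le> t * sharp_bound J n M \<rho> c"
          unfolding J'_def
          by (intro mult_left_mono t(1) sharp_bound_derivative_le J(1-4) k nk)
        then show "t * M * sharp_bound J' (\<lambda>j. n j - 1) (M - 1) \<rho> (\<lambda>j. c j * n j) \<le> 1"
          using t(2) by (simp add: mult.assoc)
      qed
      have vb: "v ` T \<subseteq> {0..sqrt \<rho>}"
        using deflation_vector_bounds[OF T(1) z(1) s' z(2) v_def] by auto
      have "0 \<le> qform T (\<lambda>i j. ?G (v i * v j)) y"
        using large by (intro rank_one_critical_fun_nonneg[OF J'(1-4) \<rho> T(1) J'(5) vb _ t']) blast+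
      \<comment> \<open>The induction hypothesis, for the deflation of \<open>z\<close> along a column \<open>s'\<close> of \<open>T\<close>.\<close>
      also have "\<dots> \<le> qform T (\<lambda>i j. ?G (z i j)) y"
      proof (rule Suc.hyps(1)[OF T(4) J'(1-4) \<rho> T(1) J'(5) z _ t' s' v_def])
        fix \<alpha> assume "\<alpha> \<in> insert (M - 1) ((\<lambda>j. n j - 1) ` J')"
        then obtain \<beta> where "\<alpha> = \<beta> - 1" "\<beta> = M \<or> (\<exists>j\<in>J'. \<beta> = n j)"
          by blast
        then show "0 \<le> \<alpha> \<and> (\<alpha> \<in> \<nat> \<or> real (card T) - 1 \<le> \<alpha>)"
          using large[of \<beta>] by simp
      qed
      finally show "0 \<le> qform T (\<lambda>i j. ?G (z i j)) y" .
    qed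
    ultimately show ?thesis
      unfolding F'_split by (rule psd_on_add)
  qed
  show ?case
  proof (rule qform_entrywise_mono[OF S(1) T(2), where F' = F' and F = "critical_fun J n M c t"
        and a = a and b = "\<lambda>i j. u i * u j"])
    show "a i j = u i * u j" if "i \<in> S" "j \<in> S" "i \<notin> T \<or> j \<notin> T" for i j
    proof -
      have "i = s \<or> j = s"
        using that by (auto simp: T_def)
      then show ?thesis
        using defl(2)[OF that(1)] defl(2)[OF that(2)] psd_on_sym[OF a that(1,2)]
        by (auto simp: mult.commute)
    qed
    show "psd_on T (\<lambda>i j. a i j - u i * u j)"
      by (rule psd_on_subset[OF S(1) defl(1) T(2)])
    show "continuous_on {0..} (critical_fun J n M c t)"
      unfolding critical_fun_def[abs_def] using expo
      by (intro continuous_on_diff continuous_on_sum continuous_on_mult_left rpow_continuous_on) auto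
    show "(critical_fun J n M c t has_real_derivative F' z) (at z)" if "0 < z" for z
      unfolding F'_def by (rule critical_fun_has_derivative[OF that])
    show "psd_on T (\<lambda>i j. F' (u i * u j + l * (a i j - u i * u j)))" if l: "0 < l" "l < 1" for l
    proof (rule step)
      show "psd_on T (\<lambda>i j. u i * u j + l * (a i j - u i * u j))"
        using l by (intro psd_on_segment psd_on_rank_one psd_on_subset[OF S(1) a T(2)]) auto
      fix i j assume "i \<in> T" "j \<in> T"
      then have ij: "i \<in> S" "j \<in> S"
        using T(2) by auto
      have "0 \<le> (1 - l) * (u i * u j) + l * a i j"
        using uu[OF ij] range[OF ij] l
        by (intro add_nonneg_nonneg mult_nonneg_nonneg[of "1 - l"] mult_nonneg_nonneg[of l]) auto
      moreover have "(1 - l) * (u i * u j) + l * a i j \<le> (1 - l) * \<rho> + l * \<rho>"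
        using uu[OF ij] range[OF ij] l
        by (intro add_mono mult_left_mono[of _ _ "1 - l"] mult_left_mono[of _ _ l]) auto
      ultimately show "0 \<le> u i * u j + l * (a i j - u i * u j)
          \<and> u i * u j + l * (a i j - u i * u j) \<le> \<rho>"
        by (simp add: algebra_simps)
    qed
  qed (use range uu in auto)
qed

section \<open>The equivalences over the reals\<close>

text \<open>
  The candidates are \<open>x\<^sub>k = t^k\<close>. Two coordinates of \<open>a x\<close> agree only if \<open>t\<close> is a zero of one of
  finitely many non-zero polynomials.
\<close>

lemma generic_positive_vector:
  fixes a :: "nat \<Rightarrow> nat \<Rightarrow> real"
  assumes distinct: "\<And>i j. i < N \<Longrightarrow> j < N \<Longrightarrow> i \<noteq> j \<Longrightarrow> \<exists>k<N. a i k \<noteq> a j k"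
  obtains x where "\<And>k. 0 < x k" "inj_on (\<lambda>i. \<Sum>k<N. a i k * x k) {..<N}"
proof -
  define Z where "Z i j = {t. 0 < t \<and> (\<Sum>k<N. (a i k - a j k) * t powr real k) = 0}" for i j
  have Zfin: "finite (Z i j)" if ij: "i < N" "j < N" "i \<noteq> j" for i j
  proof (rule ccontr)
    assume "infinite (Z i j)"
    then obtain X where X: "finite X" "card X = N" "X \<subseteq> Z i j"
      using infinite_arbitrarily_large by blast
    have "\<forall>k\<in>{..<N}. a i k - a j k = 0"
      by (rule gen_poly_eq_0[of _ "\<lambda>k. real k" X]) (use X in \<open>auto simp: Z_def inj_on_def\<close>)
    then show False
      using distinct[OF ij] by auto
  qed
  define E where "E = (\<Union>i<N. \<Union>j\<in>{..<N} - {i}. Z i j)"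
  have "finite E"
    using Zfin by (auto simp: E_def)
  then have "infinite ({0<..<1::real} - E)"
    by (intro Diff_infinite_finite) auto
  then obtain t where t: "0 < t" "t \<notin> E"
    by (metis DiffE finite.emptyI ex_in_conv greaterThanLessThan_iff)
  show thesis
  proof (rule that[of "\<lambda>k. t powr real k"])
    show "inj_on (\<lambda>i. \<Sum>k<N. a i k * t powr real k) {..<N}"
    proof (rule inj_onI, rule ccontr)
      fix i j
      assume ij: "i \<in> {..<N}" "j \<in> {..<N}" "i \<noteq> j"
        and eq: "(\<Sum>k<N. a i k * t powr real k) = (\<Sum>k<N. a j k * t powr real k)"
      have "(\<Sum>k<N. (a i k - a j k) * t powr real k) = 0"
        using eq by (simp add: left_diff_distrib sum_subtractf)
      then have "t \<in> E"
        using ij t(1) by (auto simp: E_def Z_def)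
      then show False
        using t(2) by simp
    qed
  qed (use t in simp)
qed

text \<open>
  The vector is a multiple of \<open>a x\<close> for a generic positive \<open>x\<close>. Because \<open>x > 0\<close> and \<open>a\<close> has
  non-negative entries, its zeros are exactly the zero rows.
\<close>

lemma separating_rank_one_minorant:
  fixes a :: "nat \<Rightarrow> nat \<Rightarrow> real"
  assumes a: "psd_on {..<N} a"
    and range: "\<And>i j. i < N \<Longrightarrow> j < N \<Longrightarrow> 0 \<le> a i j \<and> a i j \<le> \<rho>"
    and distinct: "\<And>i j. i < N \<Longrightarrow> j < N \<Longrightarrow> i \<noteq> j \<Longrightarrow> \<exists>k<N. a i k \<noteq> a j k"
  obtains u where "\<And>i. i < N \<Longrightarrow> 0 \<le> u i \<and> u i \<le> sqrt \<rho>" "inj_on u {..<N}"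
    "psd_on {..<N} (\<lambda>i j. a i j - u i * u j)"
    "\<And>i. i < N \<Longrightarrow> u i = 0 \<longleftrightarrow> (\<forall>j<N. a i j = 0)"
proof -
  obtain x where x: "\<And>k. 0 < x k" "inj_on (\<lambda>i. \<Sum>k<N. a i k * x k) {..<N}"
    using generic_positive_vector[of N a] distinct by metis
  define w where "w i = (\<Sum>k<N. a i k * x k)" for i
  define q where "q = qform {..<N} a x"
  define u where "u i = w i / sqrt q" for i
  have q: "0 \<le> q"
    unfolding q_def by (rule psd_on_qform[OF a])
  have null: "w i = 0" if "q = 0" "i < N" for i
    using psd_on_null_vector[OF _ a, of x i] that by (simp add: q_def w_def)
  have w0: "0 \<le> w i" if "i < N" for i
    unfolding w_def using range x(1) that
    by (intro sum_nonneg mult_nonneg_nonneg) (auto simp: less_imp_le)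
  have psd: "psd_on {..<N} (\<lambda>i j. a i j - u i * u j)"
    by (rule psd_on_deflation_along[OF a]) (simp only: u_def w_def q_def)
  show thesis
  proof (rule that[OF _ _ psd])
    show "0 \<le> u i \<and> u i \<le> sqrt \<rho>" if i: "i < N" for i
    proof -
      have "0 \<le> a i i - u i * u i"
        using psd_on_diag_nonneg[OF _ psd, of i] i by simp
      then have "(u i)\<^sup>2 \<le> \<rho>"
        using range[OF i i] by (simp add: power2_eq_square)
      then show ?thesis
        using w0[OF i] q by (auto simp: u_def intro: real_le_rsqrt)
    qed
    show "inj_on u {..<N}"
    proof (rule inj_onI)
      fix i j
      assume ij: "i \<in> {..<N}" "j \<in> {..<N}" "u i = u j"
      \<comment> \<open>If \<open>q = 0\<close> then \<open>w\<close> vanishes identically, so there is only one index.\<close>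
      then have "w i = w j"
        using null[of i] null[of j] by (cases "q = 0") (auto simp: u_def)
      then show "i = j"
        using inj_onD[OF x(2), of i j] ij by (simp add: w_def)
    qed
    show "u i = 0 \<longleftrightarrow> (\<forall>j<N. a i j = 0)" if i: "i < N" for i
    proof -
      have "u i = 0 \<longleftrightarrow> w i = 0"
        using null[OF _ i] by (auto simp: u_def)
      also have "\<dots> \<longleftrightarrow> (\<forall>k\<in>{..<N}. a i k * x k = 0)"
        unfolding w_def using range[OF i] x(1)
        by (intro sum_nonneg_eq_0_iff) (auto simp: less_imp_le)
      also have "\<dots> \<longleftrightarrow> (\<forall>j<N. a i j = 0)"
        using x(1) by (auto simp: less_le)
      finally show ?thesis .
    qed
  qed
qed

lemma sharp_bound_pos:
  assumes "finite J" "J \<noteq> {}" "0 < \<rho>" "inj_on n J" "\<And>j. j \<in> J \<Longrightarrow> n j < M"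
    "\<And>j. j \<in> J \<Longrightarrow> 0 < c j"
  shows "0 < sharp_bound J n M \<rho> c"
  unfolding sharp_bound_def
proof (rule sum_pos[OF assms(1,2)])
  fix j assume j: "j \<in> J"
  have "0 < (coeff_bound J n M (sqrt \<rho>) j)\<^sup>2"
    using coeff_bound_pos[of "sqrt \<rho>" n J j M] assms j by simp
  then show "0 < (\<Prod>i\<in>J - {j}. ((M - n i) / (n j - n i))\<^sup>2) * \<rho> powr (M - n j) / c j"
    using assms(6)[OF j] by (simp add: coeff_bound_power2[OF assms(3)])
qed

text \<open>
  The sharp inequality at the point \<open>\<surd>x\<close> alone: the other interpolation points get weight 0.
\<close>

lemma scalar_sharp_less:
  fixes n c :: "'j \<Rightarrow> real"
  assumes J: "finite J" "J \<noteq> {}" "inj_on n J" "\<And>j. j \<in> J \<Longrightarrow> n j < M" "\<And>j. j \<in> J \<Longrightarrow> 0 < c j"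
    and x: "0 < x" "x \<le> \<rho>" "card J \<ge> 2 \<or> x \<noteq> \<rho>"
  shows "rpow x M < sharp_bound J n M \<rho> c * (\<Sum>j\<in>J. c j * rpow x (n j))"
proof -
  have \<rho>: "0 < \<rho>"
    using x by simp
  have "infinite ({0<..sqrt \<rho>} - {sqrt x})"
    using \<rho> by (intro Diff_infinite_finite) (auto simp: infinite_Ioc)
  then obtain B where B: "finite B" "card B = card J - 1" "B \<subseteq> {0<..sqrt \<rho>} - {sqrt x}"
    using infinite_arbitrarily_large by blast
  define X where "X = insert (sqrt x) B"
  have "card J \<ge> 1"
    using J(1,2) by (simp add: Suc_le_eq card_gt_0_iff)
  moreover have "sqrt x \<notin> B"
    using B(3) by blast
  ultimately have X: "finite X" "card X = card J" "X \<subseteq> {0<..sqrt \<rho>}"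
    using B x \<rho> by (auto simp: X_def)
  have pick: "(\<Sum>z\<in>X. (if z = sqrt x then 1 else 0) * rpow z \<alpha>) = rpow (sqrt x) \<alpha>" for \<alpha>
    using X(1) by (intro sum_unit_vector) (auto simp: X_def)
  have sq: "(rpow (sqrt x) \<alpha>)\<^sup>2 = rpow x \<alpha>" for \<alpha>
    using x(1) by (simp add: power2_eq_square rpow_mult[symmetric])
  have "(\<Sum>z\<in>X. (if z = sqrt x then 1 else 0) * rpow z M)\<^sup>2
      < sharp_bound J n M \<rho> c
        * (\<Sum>j\<in>J. c j * (\<Sum>z\<in>X. (if z = sqrt x then 1 else 0) * rpow z (n j))\<^sup>2)"
  proof (rule power_sums_sq_less[OF J(1,3-5) \<rho> X(1,2), where z = "sqrt x"])
    show "2 \<le> card J \<or> sqrt \<rho> \<notin> X"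
    proof (cases "2 \<le> card J")
      case False
      then have "B = {}"
        using B(1,2) by simp
      then show ?thesis
        using x(3) False by (auto simp: X_def)
    qed simp
  qed (use X in \<open>auto simp: X_def\<close>)
  then show ?thesis
    unfolding pick sq .
qed

text \<open>
  What the three settings have in common. Exponents of arbitrary sign occur only together with positive entries,
  and for matrices of higher rank the exponents are natural numbers or at least \<open>N - 1\<close>.
\<close>

locale entrywise_setting =
  fixes N :: nat and \<rho> M :: real and n c :: "nat \<Rightarrow> real" and a :: "nat \<Rightarrow> nat \<Rightarrow> real"
  assumes N: "1 \<le> N" and \<rho>: "0 < \<rho>"
    and n: "strict_mono_on {..<N} n" and M: "n (N - 1) < M"
    and c: "\<And>j. j < N \<Longrightarrow> 0 < c j"
    and psd: "psd_on {..<N} a"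
    and range: "\<And>i j. i < N \<Longrightarrow> j < N \<Longrightarrow> 0 \<le> a i j \<and> a i j \<le> \<rho>"
    and zero: "\<And>i j k. i < N \<Longrightarrow> j < N \<Longrightarrow> a i j = 0 \<Longrightarrow> k < N \<Longrightarrow> 0 \<le> n k"
    and settings: "(\<exists>v. (\<forall>i<N. 0 \<le> v i) \<and> (\<forall>i<N. \<forall>j<N. a i j = v i * v j))
      \<or> (\<forall>\<alpha>\<in>insert M (n ` {..<N}). 0 \<le> \<alpha> \<and> (\<alpha> \<in> \<nat> \<or> real N - 1 \<le> \<alpha>))"
begin

abbreviation "C \<equiv> sharp_bound {..<N} n M \<rho> c"

abbreviation "h z \<equiv> \<Sum>j<N. c j * rpow z (n j)"

abbreviation "g \<equiv> critical_fun {..<N} n M c (inverse C)"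

lemma inj_n: "inj_on n {..<N}"
  using n by (rule strict_mono_on_imp_inj_on)

lemma n_less_M: "j < N \<Longrightarrow> n j < M"
  using strict_mono_onD[OF n, of j "N - 1"] M by (cases "j = N - 1") force+

lemma n_mono: "j < N \<Longrightarrow> n 0 \<le> n j"
  using strict_mono_onD[OF n, of 0 j] by (cases "j = 0") force+

lemma C_pos: "0 < C"
  using N n_less_M c \<rho> inj_n by (intro sharp_bound_pos) (auto simp: lessThan_empty_iff)

lemma inverse_C: "0 \<le> inverse C" "inverse C * C \<le> 1"
  using C_pos by auto

lemma qform_h: "qform {..<N} (\<lambda>i j. h (b i j)) y
    = (\<Sum>k<N. c k * qform {..<N} (\<lambda>i j. rpow (b i j) (n k)) y)"
  by (simp only: qform_sum qform_scale)

lemma qform_g: "qform {..<N} (\<lambda>i j. g (b i j)) y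
    = qform {..<N} (\<lambda>i j. h (b i j)) y - inverse C * qform {..<N} (\<lambda>i j. rpow (b i j) M) y"
  by (simp only: qform_h qform_critical_fun)

lemma rank_one_entries:
  assumes "\<forall>i<N. 0 \<le> v i" "\<forall>i<N. \<forall>j<N. a i j = v i * v j" "i < N"
  shows "v i \<le> sqrt \<rho>" "v i = 0 \<longleftrightarrow> a i i = 0"
  using assms range[of i i] by (auto intro!: real_le_rsqrt simp: power2_eq_square)

lemma psd_on_power_M: "psd_on {..<N} (\<lambda>i j. rpow (a i j) M)"
proof (cases "\<exists>v. (\<forall>i<N. 0 \<le> v i) \<and> (\<forall>i<N. \<forall>j<N. a i j = v i * v j)")
  case True
  then obtain v where "\<forall>i<N. \<forall>j<N. a i j = v i * v j" by blast
  then show ?thesis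
    by (intro psd_on_cong[OF _ psd_on_rank_one[of _ "\<lambda>i. rpow (v i) M"]]) (auto simp: rpow_mult)
next
  case False
  then have "M \<in> \<nat> \<or> real N - 1 \<le> M"
    using settings by blast
  then show ?thesis
    using range by (intro psd_on_rpow psd) auto
qed

lemma column_vector_bounds:
  assumes s: "s < N" and u: "u = (\<lambda>i. a i s / sqrt (a s s))" and i: "i < N"
  shows "0 \<le> u i \<and> u i \<le> sqrt \<rho>"
proof -
  have "s \<in> {..<N}" "i \<in> {..<N}"
    using s i by auto
  moreover have "0 \<le> a i j \<and> a i j \<le> \<rho>" if "i \<in> {..<N}" "j \<in> {..<N}" for i j
    using range that by simp
  ultimately show ?thesis
    using deflation_vector_bounds[OF finite_lessThan psd _ _ u, of \<rho> i] by blast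
qed

lemma column_vector_apply:
  assumes "s < N" "u = (\<lambda>i. a i s / sqrt (a s s))" "j < N"
  shows "u s * u j = a s j"
  using psd_on_deflation(2)[OF finite_lessThan psd _ assms(2), of j] assms(1,3) by simp

lemma qform_g_deflation:
  assumes "\<forall>\<alpha>\<in>insert M (n ` {..<N}). 0 \<le> \<alpha> \<and> (\<alpha> \<in> \<nat> \<or> real N - 1 \<le> \<alpha>)"
    and "s < N" "u = (\<lambda>i. a i s / sqrt (a s s))"
  shows "qform {..<N} (\<lambda>i j. g (u i * u j)) y \<le> qform {..<N} (\<lambda>i j. g (a i j)) y"
proof (rule critical_fun_deflation_mono[OF _ inj_n _ _ \<rho> _ _ psd _ _ inverse_C _ assms(3)])
  show "0 \<le> \<alpha> \<and> (\<alpha> \<in> \<nat> \<or> real (card {..<N}) - 1 \<le> \<alpha>)"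
    if "\<alpha> \<in> insert M (n ` {..<N})" for \<alpha>
    using bspec[OF assms(1) that] by simp
qed (use assms(2) n_less_M c range in simp_all)

lemma qform_g_rank_one_nonneg:
  assumes "\<And>i. i < N \<Longrightarrow> 0 \<le> u i \<and> u i \<le> sqrt \<rho>"
    and "\<And>i k. i < N \<Longrightarrow> u i = 0 \<Longrightarrow> k < N \<Longrightarrow> 0 \<le> n k"
  shows "0 \<le> qform {..<N} (\<lambda>i j. g (u i * u j)) y"
proof (rule rank_one_critical_fun_nonneg[OF _ inj_n _ _ \<rho> _ _ _ _ inverse_C])
  show "u ` {..<N} \<subseteq> {0..sqrt \<rho>}"
    using assms(1) by auto
  show "\<forall>k\<in>{..<N}. 0 \<le> n k" if "0 \<in> u ` {..<N}"
    using assms(2) that by fastforce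
qed (use n_less_M c in simp_all)

lemma qform_g_rank_one_pos:
  assumes u: "\<And>i. i < N \<Longrightarrow> 0 \<le> u i \<and> u i \<le> sqrt \<rho>" "inj_on u {..<N}"
    and u0: "\<And>i. i < N \<Longrightarrow> u i = 0 \<Longrightarrow> n 0 = 0" and one: "N = 1 \<Longrightarrow> u 0 \<noteq> sqrt \<rho>"
    and y: "z < N" "y z \<noteq> 0"
  shows "0 < qform {..<N} (\<lambda>i j. g (u i * u j)) y"
proof -
  define H where "H = (\<Sum>j<N. c j * (\<Sum>s<N. y s * rpow (u s) (n j))\<^sup>2)"
  have "(\<Sum>s<N. y s * rpow (u s) M)\<^sup>2 < C * H"
    unfolding H_def
  proof (rule rank_one_sharp_less[where n = n and c = c and z = z and y = y,
        OF _ inj_n n_less_M c \<rho> _ _ u(2)])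
    assume "0 \<in> u ` {..<N}"
    then have "n 0 = 0"
      using u0 by force
    then show "0 \<in> n ` {..<N} \<and> (\<forall>i\<in>{..<N}. 0 \<le> n i)"
      using n_mono N by force
  next
    show "2 \<le> card {..<N} \<or> sqrt \<rho> \<notin> u ` {..<N}"
      using one by (cases "N = 1") (use N in auto)
  qed (use u y in auto)
  then have "inverse C * (\<Sum>s<N. y s * rpow (u s) M)\<^sup>2 < H"
    using C_pos by (simp add: field_simps)
  then show ?thesis
    by (simp add: qform_critical_fun qform_rpow_rank_one H_def)
qed

lemma qform_g_nonneg: "0 \<le> qform {..<N} (\<lambda>i j. g (a i j)) y"
proof (cases "\<exists>v. (\<forall>i<N. 0 \<le> v i) \<and> (\<forall>i<N. \<forall>j<N. a i j = v i * v j)")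
  case True
  then obtain v where v: "\<forall>i<N. 0 \<le> v i" "\<forall>i<N. \<forall>j<N. a i j = v i * v j" by blast
  have "0 \<le> qform {..<N} (\<lambda>i j. g (v i * v j)) y"
    using v rank_one_entries[OF v] zero by (intro qform_g_rank_one_nonneg) blast+
  also have "\<dots> = qform {..<N} (\<lambda>i j. g (a i j)) y"
    using v(2) by (intro qform_cong) auto
  finally show ?thesis .
next
  case False
  then have expo: "\<forall>\<alpha>\<in>insert M (n ` {..<N}). 0 \<le> \<alpha> \<and> (\<alpha> \<in> \<nat> \<or> real N - 1 \<le> \<alpha>)"
    using settings by blast
  define u where "u = (\<lambda>i. a i 0 / sqrt (a 0 0))"
  have "0 \<le> qform {..<N} (\<lambda>i j. g (u i * u j)) y"
    using column_vector_bounds[OF _ u_def] N expo by (intro qform_g_rank_one_nonneg) auto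
  also have "\<dots> \<le> qform {..<N} (\<lambda>i j. g (a i j)) y"
    by (rule qform_g_deflation[OF expo _ u_def]) (use N in simp)
  finally show ?thesis .
qed

lemma qform_h_rank_one_pos:
  assumes u: "\<And>i. i < N \<Longrightarrow> 0 \<le> u i" "inj_on u {..<N}"
    and u0: "\<And>i. i < N \<Longrightarrow> u i = 0 \<Longrightarrow> n 0 = 0"
    and y: "z < N" "y z \<noteq> 0"
  shows "0 < qform {..<N} (\<lambda>i j. h (u i * u j)) y"
  unfolding qform_h qform_rpow_rank_one
proof (rule rank_one_sum_pos[where n = n and c = c and z = z and y = y, OF _ inj_n c _ _ u(2)])
  assume "0 \<in> u ` {..<N}"
  then show "0 \<in> n ` {..<N}"
    using u0 N by force
qed (use u y in auto)

lemma pd_on_h: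
  assumes distinct: "\<And>i j. i < N \<Longrightarrow> j < N \<Longrightarrow> i \<noteq> j \<Longrightarrow> \<exists>k<N. a i k \<noteq> a j k"
    and zero_row: "\<And>i. i < N \<Longrightarrow> \<forall>j<N. a i j = 0 \<Longrightarrow> n 0 = 0"
  shows "pd_on {..<N} (\<lambda>i j. h (a i j))"
  unfolding pd_on_def
proof (intro allI impI)
  fix y :: "nat \<Rightarrow> real"
  assume "\<exists>i\<in>{..<N}. y i \<noteq> 0"
  then obtain z where z: "z < N" "y z \<noteq> 0" by auto
  show "0 < qform {..<N} (\<lambda>i j. h (a i j)) y"
  proof (cases "\<exists>v. (\<forall>i<N. 0 \<le> v i) \<and> (\<forall>i<N. \<forall>j<N. a i j = v i * v j)")
    case True
    then obtain v where v: "\<forall>i<N. 0 \<le> v i" "\<forall>i<N. \<forall>j<N. a i j = v i * v j" by blast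
    have "0 < qform {..<N} (\<lambda>i j. h (v i * v j)) y"
    proof (rule qform_h_rank_one_pos[where u = v and y = y, OF _ _ _ z])
      show "inj_on v {..<N}"
        using distinct v(2) by (intro inj_onI) (metis lessThan_iff)
      show "n 0 = 0" if "i < N" "v i = 0" for i
        using zero_row[OF that(1)] v(2) that by simp
    qed (use v in auto)
    also have "\<dots> = qform {..<N} (\<lambda>i j. h (a i j)) y"
      using v(2) by (intro qform_cong) auto
    finally show ?thesis .
  next
    case False
    then have expo: "\<forall>\<alpha>\<in>insert M (n ` {..<N}). 0 \<le> \<alpha> \<and> (\<alpha> \<in> \<nat> \<or> real N - 1 \<le> \<alpha>)"
      using settings by blast
    obtain u where u: "\<And>i. i < N \<Longrightarrow> 0 \<le> u i \<and> u i \<le> sqrt \<rho>" "inj_on u {..<N}"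
      "psd_on {..<N} (\<lambda>i j. a i j - u i * u j)"
      "\<And>i. i < N \<Longrightarrow> u i = 0 \<longleftrightarrow> (\<forall>j<N. a i j = 0)"
      using separating_rank_one_minorant[OF psd range distinct] by blast
    have "0 < qform {..<N} (\<lambda>i j. h (u i * u j)) y"
      using u(1,4) zero_row by (intro qform_h_rank_one_pos[where u = u and y = y, OF _ u(2) _ z]) blast+
    also have "\<dots> \<le> qform {..<N} (\<lambda>i j. h (a i j)) y"
      unfolding qform_h
    proof (intro sum_mono mult_left_mono)
      fix k assume k: "k \<in> {..<N}"
      show "qform {..<N} (\<lambda>i j. rpow (u i * u j) (n k)) y
          \<le> qform {..<N} (\<lambda>i j. rpow (a i j) (n k)) y"
        using k expo range u(1) by (intro qform_rpow_mono psd_on_rank_one u(3)) auto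
      show "0 \<le> c k"
        using c k by (simp add: less_imp_le)
    qed
    finally show ?thesis .
  qed
qed

lemma pd_on_g:
  assumes s: "s < N" and distinct: "inj_on (\<lambda>j. a s j) {..<N}"
    and s0: "\<And>j. j < N \<Longrightarrow> a s j = 0 \<Longrightarrow> n 0 = 0" and one: "N = 1 \<Longrightarrow> a 0 0 \<noteq> \<rho>"
  shows "pd_on {..<N} (\<lambda>i j. g (a i j))"
  unfolding pd_on_def
proof (intro allI impI)
  fix y :: "nat \<Rightarrow> real"
  assume "\<exists>i\<in>{..<N}. y i \<noteq> 0"
  then obtain z where z: "z < N" "y z \<noteq> 0" by auto
  show "0 < qform {..<N} (\<lambda>i j. g (a i j)) y"
  proof (cases "\<exists>v. (\<forall>i<N. 0 \<le> v i) \<and> (\<forall>i<N. \<forall>j<N. a i j = v i * v j)")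
    case True
    then obtain v where v: "\<forall>i<N. 0 \<le> v i" "\<forall>i<N. \<forall>j<N. a i j = v i * v j" by blast
    have "0 < qform {..<N} (\<lambda>i j. g (v i * v j)) y"
    proof (rule qform_g_rank_one_pos[where u = v and y = y, OF _ _ _ _ z])
      show "inj_on v {..<N}"
        using inj_onD[OF distinct] v(2) s by (intro inj_onI) simp
      show "n 0 = 0" if "i < N" "v i = 0" for i
        using s0[OF that(1)] v(2) that s by simp
      show "v 0 \<noteq> sqrt \<rho>" if "N = 1"
        using one[OF that] v(2) that \<rho> by auto
    qed (use v rank_one_entries[OF v] in auto)
    also have "\<dots> = qform {..<N} (\<lambda>i j. g (a i j)) y"
      using v(2) by (intro qform_cong) auto
    finally show ?thesis .
  next
    case False
    then have expo: "\<forall>\<alpha>\<in>insert M (n ` {..<N}). 0 \<le> \<alpha> \<and> (\<alpha> \<in> \<nat> \<or> real N - 1 \<le> \<alpha>)"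
      using settings by blast
    define u where "u = (\<lambda>i. a i s / sqrt (a s s))"
    have sym: "a i s = a s i" if "i < N" for i
      using psd_on_sym[OF psd, of i s] that s by simp
    have null: "a s i = 0" if "a s s = 0" "i < N" for i
      using column_vector_apply[OF s u_def that(2)] that(1) by (simp add: u_def)
    have "0 < qform {..<N} (\<lambda>i j. g (u i * u j)) y"
    proof (rule qform_g_rank_one_pos[where u = u and y = y, OF _ _ _ _ z])
      show "0 \<le> u i \<and> u i \<le> sqrt \<rho>" if "i < N" for i
        by (rule column_vector_bounds[OF s u_def that])
      show "inj_on u {..<N}"
      proof (rule inj_onI)
        fix i j assume ij: "i \<in> {..<N}" "j \<in> {..<N}" "u i = u j"
        then have "a s i = a s j"
          using null[of i] null[of j] sym by (cases "a s s = 0") (auto simp: u_def)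
        then show "i = j"
          using inj_onD[OF distinct] ij by blast
      qed
      show "n 0 = 0" if "i < N" "u i = 0" for i
        using s0[OF that(1)] null[OF _ that(1)] sym[OF that(1)] that(2) by (auto simp: u_def)
      show "u 0 \<noteq> sqrt \<rho>" if "N = 1"
      proof
        assume "u 0 = sqrt \<rho>"
        moreover have "u 0 * u 0 = a 0 0"
          using column_vector_apply[OF s u_def, of 0] that s by simp
        ultimately show False
          using one[OF that] \<rho> by simp
      qed
    qed
    also have "\<dots> \<le> qform {..<N} (\<lambda>i j. g (a i j)) y"
      by (rule qform_g_deflation[OF expo s u_def])
    finally show ?thesis .
  qed
qed

text \<open>
  At every vector the values \<open>P\<close> and \<open>H\<close> of the forms of \<open>A^{\<circ>M}\<close> and \<open>h[A]\<close> satisfy \<open>0 \<le> P \<le> \<C> H\<close>.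
  Hence \<open>H + c' P > 0\<close> if \<open>H > 0\<close>, and \<open>P = 0\<close> if \<open>H = 0\<close>.
\<close>

lemma pd_on_perturbation:
  assumes c': "- inverse C < c'"
  shows "pd_on {..<N} (\<lambda>i j. h (a i j) + c' * rpow (a i j) M) \<longleftrightarrow> pd_on {..<N} (\<lambda>i j. h (a i j))"
proof -
  define P where "P = qform {..<N} (\<lambda>i j. rpow (a i j) M)"
  define H where "H = qform {..<N} (\<lambda>i j. h (a i j))"
  have f: "qform {..<N} (\<lambda>i j. h (a i j) + c' * rpow (a i j) M) y = H y + c' * P y" for y
    by (simp only: qform_add qform_scale P_def H_def)
  have "0 < H y + c' * P y \<longleftrightarrow> 0 < H y" for y
  proof -
    have P: "0 \<le> P y"
      unfolding P_def by (rule psd_on_qform[OF psd_on_power_M])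
    have "inverse C * P y \<le> H y"
      using qform_g_nonneg[of y] unfolding qform_g P_def H_def by simp
    then have PH: "P y \<le> C * H y"
      using C_pos by (simp add: field_simps)
    show ?thesis
    proof (cases "0 < H y")
      case True
      show ?thesis
      proof (cases "P y = 0")
        case False
        then have "- inverse C * P y < c' * P y"
          using c' P by (intro mult_strict_right_mono) auto
        then have "0 < H y + c' * P y"
          using \<open>inverse C * P y \<le> H y\<close> by simp
        then show ?thesis
          using True by simp
      qed simp
    next
      case False
      then have "C * H y \<le> 0"
        using C_pos by (simp add: mult_le_0_iff)
      then have "P y = 0"
        using P PH by linarith
      then show ?thesis by simp
    qed
  qed
  then show ?thesis
    by (simp only: pd_on_def f H_def[symmetric])
qed

text \<open>
  Only diagonal entries matter: a non-zero one excludes equality by the strict scalar inequality, unless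
  \<open>N = 1\<close> and the entry is \<open>\<rho>\<close>. If all of them vanish, so does the matrix.
\<close>

lemma equality_iff:
  "(\<forall>i<N. \<forall>j<N. rpow (a i j) M = C * h (a i j)) \<longleftrightarrow>
     N = 1 \<and> a 0 0 = \<rho> \<or> 0 < n 0 \<and> (\<forall>i<N. \<forall>j<N. a i j = 0)"
proof
  assume eq: "\<forall>i<N. \<forall>j<N. rpow (a i j) M = C * h (a i j)"
  show "N = 1 \<and> a 0 0 = \<rho> \<or> 0 < n 0 \<and> (\<forall>i<N. \<forall>j<N. a i j = 0)"
  proof (cases "\<exists>i<N. a i i \<noteq> 0")
    case True
    then obtain i where i: "i < N" "a i i \<noteq> 0" by blast
    have "0 < a i i" "a i i \<le> \<rho>"
      using range[OF i(1,1)] i(2) by auto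
    then have "rpow (a i i) M < C * h (a i i)" if "2 \<le> card {..<N} \<or> a i i \<noteq> \<rho>"
      using that N n_less_M c
      by (intro scalar_sharp_less inj_n) (auto simp: lessThan_empty_iff)
    then have "\<not> (2 \<le> card {..<N} \<or> a i i \<noteq> \<rho>)"
      using eq i(1) by auto
    then have "N = 1" "a i i = \<rho>"
      using N by auto
    then show ?thesis
      using i(1) by simp
  next
    case False
    have a0: "a i j = 0" if "i < N" "j < N" for i j
      using column_vector_apply[OF that(1) refl that(2)] False that by simp
    have nonneg: "0 \<le> n k" if "k < N" for k
      using zero[of 0 0] a0 N that by simp
    have "0 < M"
      using nonneg[of 0] n_less_M[of 0] N by simp
    have "C * h 0 = rpow 0 M"
      using eq[rule_format, of 0 0] a0[of 0 0] N by simp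
    also have "\<dots> = 0"
      using \<open>0 < M\<close> by (simp add: rpow_zero)
    finally have "C * h 0 = 0" .
    then have "h 0 = 0"
      using C_pos by simp
    moreover have "0 \<le> c j * rpow 0 (n j)" if "j \<in> {..<N}" for j
      using c[of j] that by (simp add: rpow_nonneg less_imp_le)
    ultimately have "c 0 * rpow 0 (n 0) = 0"
      using N sum_nonneg_eq_0_iff[of "{..<N}" "\<lambda>j. c j * rpow 0 (n j)"] by simp
    then have "n 0 \<noteq> 0"
      using c[of 0] N by (auto simp: rpow_zero)
    then show ?thesis
      using nonneg[of 0] N a0 by simp
  qed
next
  assume "N = 1 \<and> a 0 0 = \<rho> \<or> 0 < n 0 \<and> (\<forall>i<N. \<forall>j<N. a i j = 0)"
  then show "\<forall>i<N. \<forall>j<N. rpow (a i j) M = C * h (a i j)"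
  proof
    assume N1: "N = 1 \<and> a 0 0 = \<rho>"
    then have "{..<N} = {0}" by auto
    then have "C * h \<rho> = \<rho> powr M"
      using c[of 0] N \<rho> by (simp add: sharp_bound_def rpow_pos powr_diff)
    then show ?thesis
      using N1 \<rho> by (simp add: rpow_pos)
  next
    assume *: "0 < n 0 \<and> (\<forall>i<N. \<forall>j<N. a i j = 0)"
    have "n j \<noteq> 0" if "j < N" for j
      using n_mono[OF that] * by simp
    then have "h 0 = 0"
      by (intro sum.neutral) (auto simp: rpow_zero)
    moreover have "M \<noteq> 0"
      using n_less_M[of 0] N * by simp
    ultimately show ?thesis
      using * by (simp add: rpow_zero)
  qed
qed

end

section \<open>The constant as a ratio of Vandermonde products\<close>

lemma vdm_snoc: "vdm (xs @ [y]) = vdm xs * (\<Prod>x\<leftarrow>xs. y - x)"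
proof -
  have "(\<Prod>k<length xs. y - xs ! k) = (\<Prod>x\<leftarrow>xs. y - x)"
    by (simp add: prod.list_conv_set_nth atLeast0LessThan)
  then show ?thesis
    by (simp add: vdm_def nth_append)
qed

text \<open>
  Moving \<open>a\<close> to the end of the list only changes the sign of the Vandermonde product.
\<close>

lemma vdm_power2_insert:
  "(vdm (xs @ a # ys))\<^sup>2 = (vdm (xs @ ys))\<^sup>2 * (\<Prod>x\<leftarrow>xs @ ys. a - x)\<^sup>2"
proof (induction ys rule: rev_induct)
  case Nil
  show ?case by (simp add: vdm_snoc power_mult_distrib)
next
  case (snoc y ys)
  have "(vdm (xs @ a # ys @ [y]))\<^sup>2 = (vdm (xs @ a # ys))\<^sup>2 * (\<Prod>x\<leftarrow>xs @ a # ys. y - x)\<^sup>2"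
    using vdm_snoc[of "xs @ a # ys" y] by (simp add: power_mult_distrib)
  moreover have "(vdm (xs @ ys @ [y]))\<^sup>2 = (vdm (xs @ ys))\<^sup>2 * (\<Prod>x\<leftarrow>xs @ ys. y - x)\<^sup>2"
    using vdm_snoc[of "xs @ ys" y] by (simp add: power_mult_distrib)
  ultimately show ?case
    using snoc.IH by (simp add: power_mult_distrib power2_commute[of y a] mult_ac)
qed

lemma vdm_nonzero: "distinct xs \<Longrightarrow> vdm xs \<noteq> 0"
  by (auto simp: vdm_def nth_eq_iff_index_eq)

text \<open>
  The lists \<open>n\<close> and \<open>n\<^sub>j\<close> share all exponents except \<open>n j\<close> and \<open>M\<close>, so the Vandermonde product of the
  shared ones cancels in the ratio.
\<close>

lemma sharp_const_eq_sharp_bound: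
  assumes inj: "inj_on n {..<N}"
  shows "sharp_const N \<rho> n M c = sharp_bound {..<N} n M \<rho> c"
proof -
  have "(vdm (exps_omit N n M j))\<^sup>2 / (vdm (exps N n))\<^sup>2
      = (\<Prod>i\<in>{..<N} - {j}. ((M - n i) / (n j - n i))\<^sup>2)" if j: "j < N" for j
  proof -
    define L where "L = [0..<j] @ [Suc j..<N]"
    define xs ys where "xs = map n [0..<j]" and "ys = map n [Suc j..<N]"
    have L: "distinct L" "set L = {..<N} - {j}"
      using j by (auto simp: L_def)
    have xy: "xs @ ys = map n L"
      by (simp add: xs_def ys_def L_def)
    have "[0..<N] = [0..<j] @ j # [Suc j..<N]"
      using j by (metis less_imp_le upt_add_eq_append upt_conv_Cons le_add_diff_inverse zero_le)
    then have "exps N n = xs @ n j # ys"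
      by (simp add: exps_def xs_def ys_def)
    then have e: "(vdm (exps N n))\<^sup>2 = (vdm (xs @ ys))\<^sup>2 * (\<Prod>x\<leftarrow>xs @ ys. n j - x)\<^sup>2"
      by (simp add: vdm_power2_insert)
    have "exps_omit N n M j = (xs @ ys) @ [M]"
      by (simp add: exps_omit_def xs_def ys_def)
    then have o: "(vdm (exps_omit N n M j))\<^sup>2 = (vdm (xs @ ys))\<^sup>2 * (\<Prod>x\<leftarrow>xs @ ys. M - x)\<^sup>2"
      by (simp only: vdm_snoc power_mult_distrib)
    have "distinct (xs @ ys)"
      unfolding xy distinct_map using L inj by (auto intro: inj_on_subset)
    then have "vdm (xs @ ys) \<noteq> 0"
      by (rule vdm_nonzero)
    moreover have "(\<Prod>x\<leftarrow>xs @ ys. z - x) = (\<Prod>i\<in>{..<N} - {j}. z - n i)" for z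
      unfolding xy L(2)[symmetric] prod.distinct_set_conv_list[OF L(1)] by (simp add: o_def)
    ultimately show ?thesis
      unfolding e o by (simp add: prod_power_distrib prod_dividef power_divide)
  qed
  then show ?thesis
    by (simp add: sharp_const_def sharp_bound_def)
qed

section \<open>Complex matrices with non-negative real entries\<close>

lemma cpow_of_real: "0 \<le> z \<Longrightarrow> cpow (of_real z) \<alpha> = of_real (rpow z \<alpha>)"
  by (simp add: cpow_def rpow_def powr_of_real)

lemma form_expand:
  assumes "A \<in> carrier_mat N N" "x \<in> carrier_vec N"
  shows "(A *\<^sub>v x) \<bullet>c x = (\<Sum>i<N. \<Sum>j<N. A $$ (i, j) * x $ j * cnj (x $ i))"
  using assms by (simp add: scalar_prod_def sum_distrib_right atLeast0LessThan)

lemma Re_real_form: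
  assumes "A \<in> carrier_mat N N" "x \<in> carrier_vec N"
    and "\<And>i j. i < N \<Longrightarrow> j < N \<Longrightarrow> A $$ (i, j) = of_real (a i j)"
  shows "Re ((A *\<^sub>v x) \<bullet>c x)
    = qform {..<N} a (\<lambda>i. Re (x $ i)) + qform {..<N} a (\<lambda>i. Im (x $ i))"
  unfolding form_expand[OF assms(1,2)] qform_def Re_sum sum.distrib[symmetric]
  by (intro sum.cong refl) (simp add: assms(3) algebra_simps)

lemma Im_real_form:
  assumes "A \<in> carrier_mat N N" "x \<in> carrier_vec N"
    and "\<And>i j. i < N \<Longrightarrow> j < N \<Longrightarrow> A $$ (i, j) = of_real (a i j)"
  shows "Im ((A *\<^sub>v x) \<bullet>c x)
    = (\<Sum>i<N. \<Sum>j<N. a i j * Re (x $ i) * Im (x $ j)) - (\<Sum>i<N. \<Sum>j<N. a i j * Im (x $ i) * Re (x $ j))"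
  unfolding form_expand[OF assms(1,2)] Im_sum sum_subtractf[symmetric]
  by (intro sum.cong refl) (simp add: assms(3) algebra_simps)

lemma Im_real_form_symmetric:
  assumes "A \<in> carrier_mat N N" "x \<in> carrier_vec N"
    and "\<And>i j. i < N \<Longrightarrow> j < N \<Longrightarrow> A $$ (i, j) = of_real (a i j)"
    and sym: "\<And>i j. i < N \<Longrightarrow> j < N \<Longrightarrow> a i j = a j i"
  shows "Im ((A *\<^sub>v x) \<bullet>c x) = 0"
proof -
  have "(\<Sum>i<N. \<Sum>j<N. a i j * Re (x $ i) * Im (x $ j))
      = (\<Sum>j<N. \<Sum>i<N. a i j * Re (x $ i) * Im (x $ j))"
    by (rule sum.swap)
  also have "\<dots> = (\<Sum>i<N. \<Sum>j<N. a i j * Im (x $ i) * Re (x $ j))"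
    using sym by (intro sum.cong refl) simp
  finally have "(\<Sum>i<N. \<Sum>j<N. a i j * Re (x $ i) * Im (x $ j)) = (\<Sum>i<N. \<Sum>j<N. a i j * Im (x $ i) * Re (x $ j))" .
  moreover have "Im ((A *\<^sub>v x) \<bullet>c x) = (\<Sum>i<N. \<Sum>j<N. a i j * Re (x $ i) * Im (x $ j))
      - (\<Sum>i<N. \<Sum>j<N. a i j * Im (x $ i) * Re (x $ j))"
    by (intro Im_real_form assms(1-3))
  ultimately show ?thesis
    by linarith
qed

text \<open>
  For real symmetric entries the form at \<open>x\<close> is the sum of the real forms at \<open>Re x\<close> and \<open>Im x\<close>. Symmetry comes from
  the vector \<open>e\<^sub>p + \<i> e\<^sub>q\<close>, at which the form has imaginary part \<open>a p q - a q p\<close>.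
\<close>

lemma pos_semidef_iff_psd_on:
  assumes A: "A \<in> carrier_mat N N"
    and a: "\<And>i j. i < N \<Longrightarrow> j < N \<Longrightarrow> A $$ (i, j) = of_real (a i j)"
  shows "pos_semidef N A \<longleftrightarrow> psd_on {..<N} a"
proof
  assume psd: "pos_semidef N A"
  show "psd_on {..<N} a"
  proof (rule psd_onI)
    fix p q assume pq: "p \<in> {..<N}" "q \<in> {..<N}"
    define x where "x = vec N (\<lambda>k. Complex (if k = p then 1 else 0) (if k = q then 1 else 0))"
    have x: "x \<in> carrier_vec N" "\<And>k. k < N \<Longrightarrow> Re (x $ k) = (if k = p then 1 else 0)"
      "\<And>k. k < N \<Longrightarrow> Im (x $ k) = (if k = q then 1 else 0)"
      by (auto simp: x_def)
    have pick: "(\<Sum>i<N. \<Sum>j<N. a i j * (if i = r then 1 else 0) * (if j = t then 1 else 0)) = a r t"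
      if "r < N" "t < N" for r t
      using that sum_unit_vector(1)[of "{..<N}"] by simp
    have "Im ((A *\<^sub>v x) \<bullet>c x) = a p q - a q p"
    proof -
      have "(\<Sum>i<N. \<Sum>j<N. a i j * Re (x $ i) * Im (x $ j)) = a p q"
        unfolding pick[of p q, OF pq[unfolded lessThan_iff], symmetric]
        by (intro sum.cong refl) (simp add: x(2,3))
      moreover have "(\<Sum>i<N. \<Sum>j<N. a i j * Im (x $ i) * Re (x $ j)) = a q p"
        unfolding pick[of q p, OF pq(2,1)[unfolded lessThan_iff], symmetric]
        by (intro sum.cong refl) (simp add: x(2,3))
      moreover have "Im ((A *\<^sub>v x) \<bullet>c x) = (\<Sum>i<N. \<Sum>j<N. a i j * Re (x $ i) * Im (x $ j))
          - (\<Sum>i<N. \<Sum>j<N. a i j * Im (x $ i) * Re (x $ j))"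
        by (intro Im_real_form A x(1) a)
      ultimately show ?thesis
        by linarith
    qed
    moreover have "Im ((A *\<^sub>v x) \<bullet>c x) = 0"
    proof -
      have "0 \<le> (A *\<^sub>v x) \<bullet>c x"
        using psd x(1) unfolding pos_semidef_def by blast
      then show ?thesis
        unfolding less_eq_complex_def by simp
    qed
    ultimately show "a p q = a q p"
      by simp
  next
    fix y :: "nat \<Rightarrow> real"
    define x where "x = vec N (\<lambda>k. complex_of_real (y k))"
    have x: "x \<in> carrier_vec N"
      by (simp add: x_def)
    have "qform {..<N} a (\<lambda>i. Re (x $ i)) = qform {..<N} a y"
      "qform {..<N} a (\<lambda>i. Im (x $ i)) = qform {..<N} a (\<lambda>_. 0)"
      by (intro qform_cong; simp add: x_def)+
    moreover have "Re ((A *\<^sub>v x) \<bullet>c x)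
        = qform {..<N} a (\<lambda>i. Re (x $ i)) + qform {..<N} a (\<lambda>i. Im (x $ i))"
      by (intro Re_real_form A x a)
    ultimately have "Re ((A *\<^sub>v x) \<bullet>c x) = qform {..<N} a y"
      by (simp add: qform_def)
    moreover have "0 \<le> (A *\<^sub>v x) \<bullet>c x"
      using psd x unfolding pos_semidef_def by blast
    ultimately show "0 \<le> qform {..<N} a y"
      unfolding less_eq_complex_def by simp
  qed
next
  assume psd: "psd_on {..<N} a"
  have "0 \<le> (A *\<^sub>v x) \<bullet>c x" if x: "x \<in> carrier_vec N" for x
  proof -
    have "Re ((A *\<^sub>v x) \<bullet>c x)
        = qform {..<N} a (\<lambda>i. Re (x $ i)) + qform {..<N} a (\<lambda>i. Im (x $ i))"
      by (intro Re_real_form A x a)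
    then have "0 \<le> Re ((A *\<^sub>v x) \<bullet>c x)"
      using psd_on_qform[OF psd] by simp
    moreover have "Im ((A *\<^sub>v x) \<bullet>c x) = 0"
      by (rule Im_real_form_symmetric[where a = a]) (use A x a psd_on_sym[OF psd] in simp_all)
    ultimately show ?thesis
      unfolding less_eq_complex_def by simp
  qed
  then show "pos_semidef N A"
    using A by (simp add: pos_semidef_def)
qed

lemma pos_def_iff_pd_on:
  assumes A: "A \<in> carrier_mat N N"
    and a: "\<And>i j. i < N \<Longrightarrow> j < N \<Longrightarrow> A $$ (i, j) = of_real (a i j)"
    and sym: "\<And>i j. i < N \<Longrightarrow> j < N \<Longrightarrow> a i j = a j i"
  shows "pos_def N A \<longleftrightarrow> pd_on {..<N} a"
proof
  assume pd: "pos_def N A"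
  show "pd_on {..<N} a"
    unfolding pd_on_def
  proof (intro allI impI)
    fix y :: "nat \<Rightarrow> real"
    assume y: "\<exists>i\<in>{..<N}. y i \<noteq> 0"
    define x where "x = vec N (\<lambda>k. complex_of_real (y k))"
    have x: "x \<in> carrier_vec N"
      by (simp add: x_def)
    have "x \<noteq> 0\<^sub>v N"
      using y by (auto simp: x_def vec_eq_iff)
    have "qform {..<N} a (\<lambda>i. Re (x $ i)) = qform {..<N} a y"
      "qform {..<N} a (\<lambda>i. Im (x $ i)) = qform {..<N} a (\<lambda>_. 0)"
      by (intro qform_cong; simp add: x_def)+
    moreover have "Re ((A *\<^sub>v x) \<bullet>c x)
        = qform {..<N} a (\<lambda>i. Re (x $ i)) + qform {..<N} a (\<lambda>i. Im (x $ i))"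
      by (intro Re_real_form A x a)
    ultimately have "Re ((A *\<^sub>v x) \<bullet>c x) = qform {..<N} a y"
      by (simp add: qform_def)
    moreover have "0 < (A *\<^sub>v x) \<bullet>c x"
      using pd x \<open>x \<noteq> 0\<^sub>v N\<close> unfolding pos_def_def by blast
    ultimately show "0 < qform {..<N} a y"
      unfolding less_complex_def by simp
  qed
next
  assume pd: "pd_on {..<N} a"
  have nonneg: "0 \<le> qform {..<N} a y" for y
  proof (cases "\<exists>i\<in>{..<N}. y i \<noteq> 0")
    case True
    then show ?thesis
      using pd by (auto simp: pd_on_def less_imp_le)
  next
    case False
    then show ?thesis by (simp add: qform_def)
  qed
  have "0 < (A *\<^sub>v x) \<bullet>c x" if x: "x \<in> carrier_vec N" "x \<noteq> 0\<^sub>v N" for x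
  proof -
    obtain i where i: "i < N" "x $ i \<noteq> 0"
      using x by (auto simp: vec_eq_iff)
    then have "Re (x $ i) \<noteq> 0 \<or> Im (x $ i) \<noteq> 0"
      by (simp add: complex_eq_iff)
    moreover have "0 < qform {..<N} a y" if "y i \<noteq> 0" for y
      using pd i(1) that by (auto simp: pd_on_def)
    ultimately have "0 < qform {..<N} a (\<lambda>i. Re (x $ i)) \<or> 0 < qform {..<N} a (\<lambda>i. Im (x $ i))"
      by auto
    then have "0 < qform {..<N} a (\<lambda>i. Re (x $ i)) + qform {..<N} a (\<lambda>i. Im (x $ i))"
      using nonneg[of "\<lambda>i. Re (x $ i)"] nonneg[of "\<lambda>i. Im (x $ i)"] by linarith
    moreover have "Re ((A *\<^sub>v x) \<bullet>c x)
        = qform {..<N} a (\<lambda>i. Re (x $ i)) + qform {..<N} a (\<lambda>i. Im (x $ i))"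
      by (intro Re_real_form A x(1) a)
    moreover have "Im ((A *\<^sub>v x) \<bullet>c x) = 0"
      by (rule Im_real_form_symmetric[where a = a]) (use A x(1) a sym in simp_all)
    ultimately show ?thesis
      unfolding less_complex_def by simp
  qed
  then show "pos_def N A"
    using A by (simp add: pos_def_def)
qed

lemma singular_2x2:
  fixes a b c d x y :: "'a::field"
  assumes "a * x + b * y = 0" "c * x + d * y = 0" "x \<noteq> 0 \<or> y \<noteq> 0"
  shows "a * d = b * c"
proof -
  have "(a * d - b * c) * x = d * (a * x + b * y) - b * (c * x + d * y)"
    "(a * d - b * c) * y = a * (c * x + d * y) - c * (a * x + b * y)"
    by (simp_all add: algebra_simps)
  then show ?thesis
    unfolding assms(1,2) using assms(3) by auto
qed

lemma rank_le_1_principal_minor: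
  fixes A :: "'a::field mat"
  assumes A: "A \<in> carrier_mat N N" and rank: "vec_space.rank N A \<le> 1" and pq: "p < q" "q < N"
  shows "A $$ (p, p) * A $$ (q, q) = A $$ (p, q) * A $$ (q, p)"
proof -
  let ?I = "{p, q}"
  let ?B = "submatrix A ?I ?I"
  have "{i. i < N \<and> i \<in> ?I} = ?I"
    using pq by auto
  then have card: "card {i. i < N \<and> i \<in> ?I} = 2"
    using pq by simp
  have "{k \<in> ?I. k < p} = {}" "{k \<in> ?I. k < q} = {p}"
    using pq by auto
  then have pos: "card {k \<in> ?I. k < p} = 0" "card {k \<in> ?I. k < q} = 1"
    by simp_all
  have entry: "?B $$ (card {k \<in> ?I. k < i}, card {k \<in> ?I. k < j}) = A $$ (i, j)"
    if "i \<in> ?I" "j \<in> ?I" for i j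
    using A pq that by (intro submatrix_index_card) auto
  have B: "?B \<in> carrier_mat 2 2"
    using A card by (intro carrier_matI) (simp_all add: dim_submatrix)
  have "det ?B = 0"
    using vec_space.rank_gt_minor[OF A, of ?I ?I] rank card by fastforce
  then obtain v where v: "v \<in> carrier_vec 2" "v \<noteq> 0\<^sub>v 2" "?B *\<^sub>v v = 0\<^sub>v 2"
    using det_0_iff_vec_prod_zero_field[OF B] by blast
  have row: "?B $$ (i, 0) * v $ 0 + ?B $$ (i, 1) * v $ 1 = 0" if "i < 2" for i
  proof -
    have "(?B *\<^sub>v v) $ i = ?B $$ (i, 0) * v $ 0 + ?B $$ (i, 1) * v $ 1"
      using B v(1) that by (simp add: scalar_prod_def numeral_2_eq_2)
    then show ?thesis
      using v(3) that by simp
  qed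
  have "?B $$ (0, 0) = A $$ (p, p)" "?B $$ (0, 1) = A $$ (p, q)"
    "?B $$ (1, 0) = A $$ (q, p)" "?B $$ (1, 1) = A $$ (q, q)"
    using entry[of p p] entry[of p q] entry[of q p] entry[of q q] unfolding pos by auto
  then have eqs: "A $$ (p, p) * v $ 0 + A $$ (p, q) * v $ 1 = 0"
    "A $$ (q, p) * v $ 0 + A $$ (q, q) * v $ 1 = 0"
    using row[of 0] row[of 1] by (simp_all del: One_nat_def)
  have "v $ 0 \<noteq> 0 \<or> v $ 1 \<noteq> 0"
    using v(1,2) by (auto simp: vec_eq_iff less_2_cases_iff)
  then show ?thesis
    by (rule singular_2x2[OF eqs])
qed

text \<open>
  Principal minors suffice: subtracting \<open>u u\<^sup>T\<close> for a column with \<open>a s s > 0\<close> leaves a positive semidefinite matrix with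
  zero diagonal, and such a matrix is zero.
\<close>

lemma psd_on_rank_one_factor:
  assumes S: "finite S" and a: "psd_on S a" and nonneg: "\<And>i j. i \<in> S \<Longrightarrow> j \<in> S \<Longrightarrow> 0 \<le> a i j"
    and minors: "\<And>i j. i \<in> S \<Longrightarrow> j \<in> S \<Longrightarrow> a i i * a j j = a i j * a j i"
  shows "\<exists>v. (\<forall>i\<in>S. 0 \<le> v i) \<and> (\<forall>i\<in>S. \<forall>j\<in>S. a i j = v i * v j)"
proof -
  have vanish: "b i j = 0" if b: "psd_on S b" "\<And>k. k \<in> S \<Longrightarrow> b k k = 0" and "i \<in> S" "j \<in> S" for b i j
    using psd_on_deflation(2)[OF S b(1) that(3) refl that(4)] b(2)[OF that(3)] by simp
  show ?thesis
  proof (cases "\<exists>s\<in>S. a s s \<noteq> 0")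
    case True
    then obtain s where s: "s \<in> S" "a s s \<noteq> 0" by blast
    have ss: "0 < a s s"
      using nonneg[OF s(1,1)] s(2) by simp
    define u where "u = (\<lambda>i. a i s / sqrt (a s s))"
    have diag: "a i i - u i * u i = 0" if i: "i \<in> S" for i
      using minors[OF i s(1)] psd_on_sym[OF a i s(1)] ss by (simp add: u_def field_simps)
    have "a i j - u i * u j = 0" if "i \<in> S" "j \<in> S" for i j
      by (rule vanish[where b = "\<lambda>i j. a i j - u i * u j"])
        (use psd_on_deflation(1)[OF S a s(1) u_def] diag that in simp_all)
    moreover have "0 \<le> u i" if "i \<in> S" for i
      using nonneg[OF that s(1)] ss by (simp add: u_def)
    ultimately show ?thesis
      by (intro exI[of _ u]) auto
  next
    case False
    then show ?thesis
      using vanish[where b = a] a by (intro exI[of _ "\<lambda>_. 0"]) simp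
  qed
qed

lemma psd_mats_entries:
  assumes A: "A \<in> psd_mats N k (of_real ` I)"
  shows "A \<in> carrier_mat N N"
    and "\<And>i j. i < N \<Longrightarrow> j < N \<Longrightarrow> A $$ (i, j) = of_real (Re (A $$ (i, j))) \<and> Re (A $$ (i, j)) \<in> I"
    and "psd_on {..<N} (\<lambda>i j. Re (A $$ (i, j)))"
    and "vec_space.rank N A \<le> k"
proof -
  show carrier: "A \<in> carrier_mat N N"
    using A by (simp add: psd_mats_def pos_semidef_def)
  show entry: "A $$ (i, j) = of_real (Re (A $$ (i, j))) \<and> Re (A $$ (i, j)) \<in> I"
    if "i < N" "j < N" for i j
  proof -
    have "A $$ (i, j) \<in> elements_mat A"
      using carrier that by (auto intro: elements_matI)
    then have "A $$ (i, j) \<in> of_real ` I"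
      using A by (auto simp: psd_mats_def)
    then show ?thesis by auto
  qed
  have "pos_semidef N A"
    using A by (simp add: psd_mats_def)
  then show "psd_on {..<N} (\<lambda>i j. Re (A $$ (i, j)))"
    using pos_semidef_iff_psd_on[OF carrier, of "\<lambda>i j. Re (A $$ (i, j))"] entry by blast
  show "vec_space.rank N A \<le> k"
    using A by (simp add: psd_mats_def)
qed

lemma psd_mats_rank_one_factor:
  assumes A: "A \<in> psd_mats N 1 (of_real ` I)" and I: "I \<subseteq> {0..}"
  shows "\<exists>v. (\<forall>i<N. 0 \<le> v i) \<and> (\<forall>i<N. \<forall>j<N. Re (A $$ (i, j)) = v i * v j)"
proof -
  note e = psd_mats_entries[OF A]
  define a where "a i j = Re (A $$ (i, j))" for i j
  \<comment> \<open>The minors of size 2 vanish because the rank is at most 1.\<close>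
  have minor: "a i i * a j j = a i j * a j i" if "i < j" "j < N" for i j
  proof -
    have E: "A $$ (k, l) = complex_of_real (a k l)" if "k \<in> {i, j}" "l \<in> {i, j}" for k l
      using e(2)[of k l] that \<open>i < j\<close> \<open>j < N\<close> unfolding a_def by auto
    have "A $$ (i, i) * A $$ (j, j) = A $$ (i, j) * A $$ (j, i)"
      by (rule rank_le_1_principal_minor[OF e(1,4) that])
    then show ?thesis
      by (simp add: E flip: of_real_mult)
  qed
  have "\<exists>v. (\<forall>i\<in>{..<N}. 0 \<le> v i) \<and> (\<forall>i\<in>{..<N}. \<forall>j\<in>{..<N}. a i j = v i * v j)"
  proof (rule psd_on_rank_one_factor)
    show "psd_on {..<N} a"
      using e(3) by (simp add: a_def[abs_def])
    show "0 \<le> a i j" if "i \<in> {..<N}" "j \<in> {..<N}" for i j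
      using e(2)[of i j] that I by (auto simp: a_def)
    show "a i i * a j j = a i j * a j i" if "i \<in> {..<N}" "j \<in> {..<N}" for i j
      using minor[of i j] minor[of j i] that by (cases i j rule: linorder_cases) (auto simp: mult.commute)
  qed simp
  then show ?thesis
    by (simp add: a_def Ball_def)
qed

lemma admissible_entrywise_setting:
  assumes N: "1 \<le> N" and \<rho>: "0 < \<rho>"
    and n: "strict_mono_on {..<N} n" and M: "n (N - 1) < M"
    and adm: "admissible N \<rho> n M P0" and c: "\<forall>j<N. 0 < c j" and A: "A \<in> P0"
  shows "A \<in> carrier_mat N N"
    and "\<And>i j. i < N \<Longrightarrow> j < N \<Longrightarrow> A $$ (i, j) = of_real (Re (A $$ (i, j)))"
    and "entrywise_setting N \<rho> M n c (\<lambda>i j. Re (A $$ (i, j)))"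
proof -
  let ?a = "\<lambda>i j. Re (A $$ (i, j))"
  let ?rank_one = "\<exists>v. (\<forall>i<N. 0 \<le> v i) \<and> (\<forall>i<N. \<forall>j<N. ?a i j = v i * v j)"
  let ?expo = "\<forall>\<alpha>\<in>insert M (n ` {..<N}). 0 \<le> \<alpha> \<and> (\<alpha> \<in> \<nat> \<or> real N - 1 \<le> \<alpha>)"
  consider (1) "A \<in> psd_mats N 1 (of_real ` {0<..<\<rho>})"
    | (2) "A \<in> psd_mats N 1 (of_real ` {0..\<rho>})" "n ` {..<N} \<union> {M} \<subseteq> {0..}"
    | (3) "A \<in> psd_mats N N (of_real ` {0..\<rho>})" "n ` {..<N} \<union> {M} \<subseteq> \<nat> \<union> {real N - 1..}"
    using adm A unfolding admissible_def by blast
  then have "A \<in> carrier_mat N N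
      \<and> (\<forall>i<N. \<forall>j<N. A $$ (i, j) = of_real (?a i j) \<and> 0 \<le> ?a i j \<and> ?a i j \<le> \<rho>
          \<and> (?a i j = 0 \<longrightarrow> (\<forall>k<N. 0 \<le> n k)))
      \<and> psd_on {..<N} ?a \<and> (?rank_one \<or> ?expo)"
  proof cases
    case 1
    note e = psd_mats_entries[OF 1]
    have "?rank_one"
      by (rule psd_mats_rank_one_factor[OF 1]) auto
    moreover have "A $$ (i, j) = of_real (?a i j) \<and> 0 < ?a i j \<and> ?a i j < \<rho>" if "i < N" "j < N" for i j
      using e(2)[OF that] by simp
    ultimately show ?thesis
      using e(1,3) by (simp add: less_imp_le less_imp_neq[symmetric])
  next
    case 2
    note e = psd_mats_entries[OF 2(1)]
    have "?rank_one"
      by (rule psd_mats_rank_one_factor[OF 2(1)]) auto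
    moreover have "A $$ (i, j) = of_real (?a i j) \<and> 0 \<le> ?a i j \<and> ?a i j \<le> \<rho>" if "i < N" "j < N" for i j
      using e(2)[OF that] by simp
    moreover have "\<forall>k<N. 0 \<le> n k"
      using 2(2) by auto
    ultimately show ?thesis
      using e(1,3) by simp
  next
    case 3
    note e = psd_mats_entries[OF 3(1)]
    have "?expo"
    proof
      fix \<alpha> assume "\<alpha> \<in> insert M (n ` {..<N})"
      then have "\<alpha> \<in> \<nat> \<or> real N - 1 \<le> \<alpha>"
        using 3(2) by auto
      then show "0 \<le> \<alpha> \<and> (\<alpha> \<in> \<nat> \<or> real N - 1 \<le> \<alpha>)"
        using N by (auto elim: Nats_cases)
    qed
    moreover have "A $$ (i, j) = of_real (?a i j) \<and> 0 \<le> ?a i j \<and> ?a i j \<le> \<rho>" if "i < N" "j < N" for i j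
      using e(2)[OF that] by simp
    moreover have "\<forall>k<N. 0 \<le> n k"
      using \<open>?expo\<close> by simp
    ultimately show ?thesis
      using e(1,3) by simp
  qed
  then show "A \<in> carrier_mat N N"
    and "\<And>i j. i < N \<Longrightarrow> j < N \<Longrightarrow> A $$ (i, j) = of_real (?a i j)"
    and "entrywise_setting N \<rho> M n c ?a"
    using N \<rho> n M c by (simp_all add: entrywise_setting_def)
qed

lemma pos_def_map_mat_iff:
  assumes A: "A \<in> carrier_mat N N"
    and a: "\<And>i j. i < N \<Longrightarrow> j < N \<Longrightarrow> A $$ (i, j) = of_real (a i j) \<and> 0 \<le> a i j \<and> a i j = a j i"
    and F: "\<And>z. 0 \<le> z \<Longrightarrow> F (of_real z) = of_real (\<phi> z)"
  shows "pos_def N (map_mat F A) \<longleftrightarrow> pd_on {..<N} (\<lambda>i j. \<phi> (a i j))"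
proof (rule pos_def_iff_pd_on)
  show "map_mat F A $$ (i, j) = of_real (\<phi> (a i j))" if "i < N" "j < N" for i j
    using A a[OF that] F that by simp
  show "\<phi> (a i j) = \<phi> (a j i)" if "i < N" "j < N" for i j
    using a[OF that] by simp
qed (use A in simp)

lemma outer_self_loewner_iff:
  assumes A: "A \<in> carrier_mat N N"
    and a: "\<And>i j. i < N \<Longrightarrow> j < N \<Longrightarrow> A $$ (i, j) = of_real (a i j)"
    and u: "u \<in> carrier_vec N" "\<And>i. i < N \<Longrightarrow> u $ i = of_real (v i)"
  shows "loewner_le N (outer_self u) A \<longleftrightarrow> psd_on {..<N} (\<lambda>i j. a i j - v i * v j)"
  unfolding loewner_le_def
proof (rule pos_semidef_iff_psd_on)
  have dim: "dim_vec u = N"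
    using u(1) by simp
  show "A - outer_self u \<in> carrier_mat N N"
    using A dim by (simp add: outer_self_def minus_carrier_mat)
  show "(A - outer_self u) $$ (i, j) = of_real (a i j - v i * v j)" if "i < N" "j < N" for i j
    using A a[OF that] u(2) that dim by (simp add: outer_self_def)
qed

lemma separating_vector_iff_rows_distinct:
  assumes A: "A \<in> carrier_mat N N"
    and a: "\<And>i j. i < N \<Longrightarrow> j < N \<Longrightarrow> A $$ (i, j) = of_real (a i j)"
    and psd: "psd_on {..<N} a"
    and range: "\<And>i j. i < N \<Longrightarrow> j < N \<Longrightarrow> 0 \<le> a i j \<and> a i j \<le> \<rho>"
  shows "(\<exists>u\<in>carrier_vec N. (\<forall>i<N. u $ i \<in> of_real ` {0..sqrt \<rho>})
        \<and> inj_on (\<lambda>i. u $ i) {..<N} \<and> loewner_le N (outer_self u) A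
        \<and> ((\<exists>i<N. u $ i = 0) \<longleftrightarrow> (\<exists>i<N. \<forall>j<N. a i j = 0)))
    \<longleftrightarrow> (\<forall>i<N. \<forall>j<N. i \<noteq> j \<longrightarrow> (\<exists>k<N. a i k \<noteq> a j k))" (is "?L \<longleftrightarrow> ?R")
proof
  assume ?L
  then obtain u where u: "u \<in> carrier_vec N" "\<forall>i<N. u $ i \<in> of_real ` {0..sqrt \<rho>}"
    "inj_on (\<lambda>i. u $ i) {..<N}" "loewner_le N (outer_self u) A"
    by blast
  define v where "v i = Re (u $ i)" for i
  have v: "u $ i = of_real (v i)" if "i < N" for i
    using u(2) that by (auto simp: v_def)
  have "psd_on {..<N} (\<lambda>i j. a i j - v i * v j)"
    using outer_self_loewner_iff[OF A a u(1) v] u(4) by blast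
  moreover have "inj_on v {..<N}"
    using inj_onD[OF u(3)] v by (intro inj_onI) simp
  ultimately have "\<exists>k\<in>{..<N}. a i k \<noteq> a j k" if "i < N" "j < N" "i \<noteq> j" for i j
    using that psd_on_sym[OF psd]
    by (intro rank_one_minorant_rows_distinct[where u = v]) auto
  then show ?R by auto
next
  assume ?R
  then have distinct: "\<exists>k<N. a i k \<noteq> a j k" if "i < N" "j < N" "i \<noteq> j" for i j
    using that by blast
  obtain v where v: "\<And>i. i < N \<Longrightarrow> 0 \<le> v i \<and> v i \<le> sqrt \<rho>" "inj_on v {..<N}"
    "psd_on {..<N} (\<lambda>i j. a i j - v i * v j)"
    "\<And>i. i < N \<Longrightarrow> v i = 0 \<longleftrightarrow> (\<forall>j<N. a i j = 0)"
    using separating_rank_one_minorant[OF psd range distinct] by blast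
  define u where "u = vec N (\<lambda>i. complex_of_real (v i))"
  have u: "u \<in> carrier_vec N" "\<And>i. i < N \<Longrightarrow> u $ i = of_real (v i)"
    by (simp_all add: u_def)
  show ?L
  proof (intro bexI[OF _ u(1)] conjI)
    show "\<forall>i<N. u $ i \<in> of_real ` {0..sqrt \<rho>}"
      using v(1) u(2) by auto
    show "inj_on (\<lambda>i. u $ i) {..<N}"
      using inj_onD[OF v(2)] u(2) by (intro inj_onI) simp
    show "loewner_le N (outer_self u) A"
      using outer_self_loewner_iff[OF A a u] v(3) by blast
    show "(\<exists>i<N. u $ i = 0) \<longleftrightarrow> (\<exists>i<N. \<forall>j<N. a i j = 0)"
      using u(2) v(4) by auto
  qed
qed

lemma inj_on_row_iff:
  assumes A: "A \<in> carrier_mat N N"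
    and a: "\<And>i j. i < N \<Longrightarrow> j < N \<Longrightarrow> A $$ (i, j) = of_real (a i j)"
  shows "inj_on (row A) {..<N} \<longleftrightarrow> (\<forall>i<N. \<forall>j<N. i \<noteq> j \<longrightarrow> (\<exists>k<N. a i k \<noteq> a j k))"
proof -
  have "row A i = row A j \<longleftrightarrow> (\<forall>k<N. a i k = a j k)" if "i < N" "j < N" for i j
    using A a that by (auto simp: vec_eq_iff)
  then have "inj_on (row A) {..<N} \<longleftrightarrow> (\<forall>i<N. \<forall>j<N. (\<forall>k<N. a i k = a j k) \<longrightarrow> i = j)"
    by (simp add: inj_on_def Ball_def)
  then show ?thesis by blast
qed

lemma has_zero_row_iff:
  assumes A: "A \<in> carrier_mat N N"
    and a: "\<And>i j. i < N \<Longrightarrow> j < N \<Longrightarrow> A $$ (i, j) = of_real (a i j)"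
  shows "has_zero_row N A \<longleftrightarrow> (\<exists>i<N. \<forall>j<N. a i j = 0)"
proof -
  have "row A i = 0\<^sub>v N \<longleftrightarrow> (\<forall>k<N. a i k = 0)" if "i < N" for i
    using A a that by (auto simp: vec_eq_iff)
  then show ?thesis
    by (auto simp: has_zero_row_def)
qed

theorem theorem2p8:
  fixes N :: nat and \<rho> M c' :: real and n c :: "nat \<Rightarrow> real"
    and P0 :: "complex mat set" and C :: real and h f g :: "complex \<Rightarrow> complex"
  assumes "N \<ge> 1" and "\<rho> > 0"
    and "strict_mono_on {..<N} n" and "n (N - 1) < M"
    and "admissible N \<rho> n M P0"
    and "\<And>j. j < N \<Longrightarrow> c j > 0"
    and "C = sharp_const N \<rho> n M c"
    and "c' > - inverse C"
    and "h = (\<lambda>z. \<Sum>j<N. of_real (c j) * cpow z (n j))"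
    and "f = (\<lambda>z. h z + of_real c' * cpow z M)"
    and "g = (\<lambda>z. h z - of_real (inverse C) * cpow z M)"
  shows
    "(\<forall>A\<in>P0. (has_zero_row N A \<longrightarrow> n 0 = 0) \<longrightarrow>
        ((\<exists>u\<in>carrier_vec N. (\<forall>i<N. u $ i \<in> of_real ` {0..sqrt \<rho>})
             \<and> inj_on (\<lambda>i. u $ i) {..<N}
             \<and> loewner_le N (outer_self u) A
             \<and> ((\<exists>i<N. u $ i = 0) \<longleftrightarrow> has_zero_row N A))
          \<longleftrightarrow> inj_on (row A) {..<N})
      \<and> (inj_on (row A) {..<N} \<longleftrightarrow> pos_def N (map_mat h A))
      \<and> (pos_def N (map_mat h A) \<longleftrightarrow> pos_def N (map_mat f A)))
   \<and> (\<forall>A\<in>P0. pos_def N (map_mat h A) \<longleftrightarrow> pos_def N (map_mat f A))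
   \<and> (\<forall>A\<in>P0. \<not> (N = 1 \<and> A = mat 1 1 (\<lambda>_. of_real \<rho>)) \<longrightarrow>
        (\<exists>i<N. inj_on (\<lambda>j. A $$ (i, j)) {..<N} \<and> ((\<exists>j<N. A $$ (i, j) = 0) \<longrightarrow> n 0 = 0)) \<longrightarrow>
        pos_def N (map_mat g A))
   \<and> (\<forall>A\<in>P0. map_mat (\<lambda>z. cpow z M) A = of_real C \<cdot>\<^sub>m map_mat h A \<longleftrightarrow>
        (N = 1 \<and> A = mat 1 1 (\<lambda>_. of_real \<rho>)) \<or> (n 0 > 0 \<and> A = 0\<^sub>m N N))"
proof -
  define hr where "hr z = (\<Sum>j<N. c j * rpow z (n j))" for z
  have inj: "inj_on n {..<N}"
    using assms(3) by (rule strict_mono_on_imp_inj_on)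
  have C: "C = sharp_bound {..<N} n M \<rho> c"
    unfolding assms(7) by (rule sharp_const_eq_sharp_bound[OF inj])
  have c_pos: "\<forall>j<N. 0 < c j"
    using assms(6) by blast
  have h: "h (of_real z) = of_real (hr z)" if "0 \<le> z" for z
    using that by (simp add: assms(9) hr_def cpow_of_real)
  have f: "f (of_real z) = of_real (hr z + c' * rpow z M)" if "0 \<le> z" for z
    using that h by (simp add: assms(10) cpow_of_real)
  have g: "g (of_real z) = of_real (critical_fun {..<N} n M c (inverse C) z)" if "0 \<le> z" for z
    using that h by (simp add: assms(11) cpow_of_real critical_fun_def hr_def)
  have main: "((has_zero_row N A \<longrightarrow> n 0 = 0) \<longrightarrow>
        ((\<exists>u\<in>carrier_vec N. (\<forall>i<N. u $ i \<in> of_real ` {0..sqrt \<rho>})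
             \<and> inj_on (\<lambda>i. u $ i) {..<N}
             \<and> loewner_le N (outer_self u) A
             \<and> ((\<exists>i<N. u $ i = 0) \<longleftrightarrow> has_zero_row N A))
          \<longleftrightarrow> inj_on (row A) {..<N})
      \<and> (inj_on (row A) {..<N} \<longleftrightarrow> pos_def N (map_mat h A)))
   \<and> (pos_def N (map_mat h A) \<longleftrightarrow> pos_def N (map_mat f A))
   \<and> (\<not> (N = 1 \<and> A = mat 1 1 (\<lambda>_. of_real \<rho>)) \<longrightarrow>
        (\<exists>i<N. inj_on (\<lambda>j. A $$ (i, j)) {..<N} \<and> ((\<exists>j<N. A $$ (i, j) = 0) \<longrightarrow> n 0 = 0)) \<longrightarrow>
        pos_def N (map_mat g A))
   \<and> (map_mat (\<lambda>z. cpow z M) A = of_real C \<cdot>\<^sub>m map_mat h A \<longleftrightarrow>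
        (N = 1 \<and> A = mat 1 1 (\<lambda>_. of_real \<rho>)) \<or> (n 0 > 0 \<and> A = 0\<^sub>m N N))"
    (is "(_ \<longrightarrow> ?I1 \<and> ?I2) \<and> ?I3 \<and> ?I4 \<and> ?I5") if A: "A \<in> P0" for A
  proof -
    define a where "a i j = Re (A $$ (i, j))" for i j
    note es = admissible_entrywise_setting[OF assms(1-5) c_pos A, folded a_def]
    note car = es(1) and ent = es(2)
    interpret entrywise_setting N \<rho> M n c a
      by (rule es(3))
    have sym: "a i j = a j i" if "i < N" "j < N" for i j
      using psd_on_sym[OF psd, of i j] that by simp
    have entries: "A $$ (i, j) = of_real (a i j) \<and> 0 \<le> a i j \<and> a i j = a j i" if "i < N" "j < N" for i j
      using ent[OF that] range[OF that] sym[OF that] by simp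
    have ph: "pos_def N (map_mat h A) \<longleftrightarrow> pd_on {..<N} (\<lambda>i j. hr (a i j))"
      by (rule pos_def_map_mat_iff[where a = a and \<phi> = hr, OF car entries h])
    have pf: "pos_def N (map_mat f A) \<longleftrightarrow> pd_on {..<N} (\<lambda>i j. hr (a i j) + c' * rpow (a i j) M)"
      by (rule pos_def_map_mat_iff[where a = a and \<phi> = "\<lambda>z. hr z + c' * rpow z M",
            OF car entries f])
    have pg: "pos_def N (map_mat g A)
        \<longleftrightarrow> pd_on {..<N} (\<lambda>i j. critical_fun {..<N} n M c (inverse C) (a i j))"
      by (rule pos_def_map_mat_iff[where a = a and \<phi> = "critical_fun {..<N} n M c (inverse C)",
            OF car entries g])
    have rows: "inj_on (row A) {..<N} \<longleftrightarrow> (\<forall>i<N. \<forall>j<N. i \<noteq> j \<longrightarrow> (\<exists>k<N. a i k \<noteq> a j k))"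
      by (rule inj_on_row_iff[where a = a, OF car ent])
    have zrow: "has_zero_row N A \<longleftrightarrow> (\<exists>i<N. \<forall>j<N. a i j = 0)"
      by (rule has_zero_row_iff[where a = a, OF car ent])
    have one: "N = 1 \<and> A = mat 1 1 (\<lambda>_. of_real \<rho>) \<longleftrightarrow> N = 1 \<and> a 0 0 = \<rho>"
      using car ent[of 0 0] by (auto simp: mat_eq_iff)
    have I1: ?I1
      unfolding rows zrow by (rule separating_vector_iff_rows_distinct[where a = a, OF car ent psd range])
    have I2: ?I2 if "has_zero_row N A \<longrightarrow> n 0 = 0"
      unfolding rows ph
    proof
      assume "\<forall>i<N. \<forall>j<N. i \<noteq> j \<longrightarrow> (\<exists>k<N. a i k \<noteq> a j k)"
      then show "pd_on {..<N} (\<lambda>i j. hr (a i j))"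
        unfolding hr_def using that zrow by (intro pd_on_h) auto
    next
      assume pd: "pd_on {..<N} (\<lambda>i j. hr (a i j))"
      have "\<exists>k\<in>{..<N}. a i k \<noteq> a j k" if "i < N" "j < N" "i \<noteq> j" for i j
        by (rule pd_on_rows_distinct[where a = a and \<phi> = hr, OF _ pd]) (use sym that in auto)
      then show "\<forall>i<N. \<forall>j<N. i \<noteq> j \<longrightarrow> (\<exists>k<N. a i k \<noteq> a j k)"
        by auto
    qed
    have I3: ?I3
      unfolding ph pf hr_def using pd_on_perturbation assms(8) by (simp add: C)
    have I4: ?I4
    proof (intro impI)
      assume no: "\<not> (N = 1 \<and> A = mat 1 1 (\<lambda>_. of_real \<rho>))"
        and "\<exists>i<N. inj_on (\<lambda>j. A $$ (i, j)) {..<N} \<and> ((\<exists>j<N. A $$ (i, j) = 0) \<longrightarrow> n 0 = 0)"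
      then obtain s where s: "s < N" "inj_on (\<lambda>j. A $$ (s, j)) {..<N}"
        "(\<exists>j<N. A $$ (s, j) = 0) \<longrightarrow> n 0 = 0"
        by blast
      have "inj_on (\<lambda>j. a s j) {..<N}"
        using inj_onD[OF s(2)] ent[OF s(1)] by (intro inj_onI) simp
      then show "pos_def N (map_mat g A)"
        unfolding pg C
      proof (rule pd_on_g[OF s(1)])
        show "n 0 = 0" if "j < N" "a s j = 0" for j
          using s(3) ent[OF s(1) that(1)] that by auto
        show "a 0 0 \<noteq> \<rho>" if "N = 1"
          using no one that by blast
      qed
    qed
    have I5: ?I5
    proof -
      have "map_mat (\<lambda>z. cpow z M) A = of_real C \<cdot>\<^sub>m map_mat h A
          \<longleftrightarrow> (\<forall>i<N. \<forall>j<N. cpow (A $$ (i, j)) M = of_real C * h (A $$ (i, j)))"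
        using car by (auto simp: mat_eq_iff)
      also have "\<dots> \<longleftrightarrow> (\<forall>i<N. \<forall>j<N. rpow (a i j) M = C * hr (a i j))"
      proof -
        have "cpow (A $$ (i, j)) M = of_real C * h (A $$ (i, j)) \<longleftrightarrow> rpow (a i j) M = C * hr (a i j)"
          if "i < N" "j < N" for i j
          using entries[OF that] by (simp add: cpow_of_real h of_real_mult[symmetric] del: of_real_mult)
        then show ?thesis by auto
      qed
      also have "\<dots> \<longleftrightarrow> N = 1 \<and> a 0 0 = \<rho> \<or> 0 < n 0 \<and> (\<forall>i<N. \<forall>j<N. a i j = 0)"
        unfolding hr_def C by (rule equality_iff)
      also have "(\<forall>i<N. \<forall>j<N. a i j = 0) \<longleftrightarrow> A = 0\<^sub>m N N"
        using car ent by (auto simp: mat_eq_iff)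
      finally show ?thesis
        unfolding one .
    qed
    show ?thesis
      using I1 I2 I3 I4 I5 by blast
  qed
  show ?thesis
    using main by blast
qed

end
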